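(* Consider $n$ agents $1,\dots,n$ with positions $x_1(t),\dots,x_n(t)\in\mathbb{R}$ at each time $t\ge 0$, and a connected undirected sensing graph $G$ on $\{1,\dots,n\}$ with edge set $E$. Let $\bar w>0$, let $w_{ji}(t)$ be arbitrary measurable disturbances with $|w_{ji}(t)|\le\bar w$ for all $t\ge0$ and all $(i,j)\in E$, and let $D_{ji}$, $(i,j)\in E$, be any realizable desired distances, i.e. there exist $p_1,\dots,p_n\in\mathbb{R}$ such that $D_{ji}=p_j-p_i$ for all $(i,j)\in E$. Let $(T_w)_w$ be any class of nondecreasing functions $T_w:\mathbb{R}\to\mathbb{R}$ for which $T_w(z)=0$ if and only if $|z|\le w$, and let $k>0$. Suppose that $x(t)$ evolves under the control law $$\dot x_i(t)=k\,T_{d(i)\bar w}\left(\sum_{j:(i,j)\in E}\left(\hat\Delta_{ji}(t)-D_{ji}\right)\right),\qquad \hat\Delta_{ji}(t)=x_j(t)-x_i(t)+w_{ji}(t),$$ for $i=1,\dots,n$, where $d(i)$ is the degree of agent $i$ in $G$. Then: (a) $x(t)$ converges: $x^*=\lim_{t\to\infty}x(t)$ exists, and it satisfies, for every agent $i$, $$\left|\sum_{j:(i,j)\in E}\left(x_j^*-x_i^*-D_{ji}\right)\right|\le 2\,d(i)\,\bar w.$$ (b) For every agent $i$ and all times $t\ge 0$, $$p_i+\min_j\left(x_j(0)-p_j\right)\le x_i(t)\le p_i+\max_j\left(x_j(0)-p_j\right).$$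
   Context: The graph $G$ is undirected, without self-loops: $(i,j)\in E$ if and only if $(j,i)\in E$; $(i,j)\in E$ means that $i$ can sense the relative position of $j$ with some noise and vice versa. The disturbances $w_{ji}$ and $w_{ij}$ of the two agents of an edge may differ, and the $w_{ji}$ need not be continuous in $t$. A trajectory evolving under the control law is a function $x:[0,\infty)\to\mathbb{R}^n$ that is absolutely continuous on every compact interval and satisfies the displayed differential equation for almost every $t\ge0$. The functions $T_w$ are threshold (deadzone) functions, e.g. $T_w(z)=z$ if $|z|>w$ and $T_w(z)=0$ otherwise. *)

theory Defs
  imports "HOL-Analysis.Analysis"
begin

(* Intended for intervals S. A finite collection of subintervals is given by the set of its
   endpoint pairs; only the open interiors are required to be disjoint. The constant
   absolutely_continuous is about measures, not functions. *)
definition absolutely_continuous_fun_on :: "real set \<Rightarrow> (real \<Rightarrow> 'a::real_normed_vector) \<Rightarrow> bool" where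
  "absolutely_continuous_fun_on S f \<longleftrightarrow>
     (\<forall>\<epsilon>>0. \<exists>\<delta>>0. \<forall>F :: (real \<times> real) set.
        finite F \<longrightarrow>
        (\<forall>(u, v)\<in>F. u \<le> v \<and> {u..v} \<subseteq> S) \<longrightarrow>
        disjoint_family_on (\<lambda>(u, v). {u<..<v}) F \<longrightarrow>
        (\<Sum>(u, v)\<in>F. v - u) < \<delta> \<longrightarrow>
        (\<Sum>(u, v)\<in>F. norm (f v - f u)) < \<epsilon>)"

(* The agents are the elements of a finite type, and an undirected graph is a symmetric
   irreflexive edge relation on them. *)
definition undirected_graph :: "('n \<times> 'n) set \<Rightarrow> bool" where
  "undirected_graph E \<longleftrightarrow> sym E \<and> irrefl E"

definition connected_graph :: "('n \<times> 'n) set \<Rightarrow> bool" where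
  "connected_graph E \<longleftrightarrow> (\<forall>i j. (i, j) \<in> E\<^sup>*)"

definition graph_degree :: "('n \<times> 'n) set \<Rightarrow> 'n \<Rightarrow> nat" where
  "graph_degree E i = card {j. (i, j) \<in> E}"

(* Thresholds are nonnegative; threshold 0 arises only for the one-vertex graph. *)
definition deadzone_family :: "(real \<Rightarrow> real \<Rightarrow> real) \<Rightarrow> bool" where
  "deadzone_family T \<longleftrightarrow>
     (\<forall>w\<ge>0. mono (T w) \<and> (\<forall>z. T w z = 0 \<longleftrightarrow> \<bar>z\<bar> \<le> w))"

(* The noisy measurement by agent i of the relative position of agent j; the disturbance
   w j i carries the indices in the same order. *)
definition measured_displacement ::
    "('n \<Rightarrow> 'n \<Rightarrow> real \<Rightarrow> real) \<Rightarrow> (real \<Rightarrow> real ^ 'n) \<Rightarrow> 'n \<Rightarrow> 'n \<Rightarrow> real \<Rightarrow> real" where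
  "measured_displacement w x j i t = x t $ j - x t $ i + w j i t"

(* Only the values of x on [0, infinity) matter; the derivative is taken within that set. *)
definition evolves_under_control_law ::
    "('n::finite \<times> 'n) set \<Rightarrow> real \<Rightarrow> (real \<Rightarrow> real \<Rightarrow> real) \<Rightarrow> real \<Rightarrow> ('n \<Rightarrow> 'n \<Rightarrow> real) \<Rightarrow>
     ('n \<Rightarrow> 'n \<Rightarrow> real \<Rightarrow> real) \<Rightarrow> (real \<Rightarrow> real ^ 'n) \<Rightarrow> bool" where
  "evolves_under_control_law E k T wbar D w x \<longleftrightarrow>
     (\<forall>a b. 0 \<le> a \<longrightarrow> a \<le> b \<longrightarrow> absolutely_continuous_fun_on {a..b} x) \<and>
     (AE t in lebesgue_on {0..}. \<forall>i.
        ((\<lambda>s. x s $ i) has_real_derivative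
           k * T (real (graph_degree E i) * wbar)
                 (\<Sum>j | (i, j) \<in> E. measured_displacement w x j i t - D j i))
        (at t within {0..}))"

end

theory Submission
  imports Defs
begin

text \<open>
  In the coordinates \<open>y\<^sub>i = x\<^sub>i - p\<^sub>i\<close> the desired distances disappear: agent \<open>i\<close> moves with velocity
  \<open>k T (s\<^sub>i + n\<^sub>i)\<close>, where \<open>T\<close> is the deadzone function of threshold \<open>d(i) w\<close>, where
  \<open>s\<^sub>i = \<Sum>\<^sub>j (y\<^sub>j - y\<^sub>i)\<close> is the pull of its neighbours, and where the total noise satisfies
  \<open>\<bar>n\<^sub>i\<bar> \<le> d(i) w\<close>. The threshold is just large enough for noise
  alone never to cause motion, nor to reverse it: if \<open>y\<^sub>i\<close> moves up then \<open>s\<^sub>i > 0\<close>, and if it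
  moves down then \<open>s\<^sub>i < 0\<close>. Almost everything follows from this sign condition, which is what the
  locale \<open>neighbour_driven_flow\<close> records. How fast an agent moves remains arbitrary; in particular
  an agent may stand still although it is pulled.

  A maximal agent is not pulled up, so \<open>max\<^sub>i y\<^sub>i\<close> does not increase and \<open>min\<^sub>i y\<^sub>i\<close> does not decrease
  (\<open>stays_below\<close>, \<open>stays_above\<close>). This is part (b), and it makes the trajectory bounded, so that it
  has a limit point \<open>z\<close>. Let \<open>V\<close> be half the sum of squared differences over the undirected edges. Its
  gradient is \<open>-s\<close>, so along the flow \<open>V' = - \<Sum>\<^sub>i s\<^sub>i y\<^sub>i' \<le> 0\<close>. This does not yet give convergence,
  because the level sets of \<open>V\<close> are large and the dissipation can be arbitrarily weak. There are two
  cases.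

  If no agent is pulled at \<open>z\<close>, then connectedness makes all entries of \<open>z\<close> equal, and the squeeze
  between minimum and maximum forces \<open>y \<rightarrow> z\<close> (\<open>converges_to_consensus\<close>).

  If agent \<open>l\<close> is pulled at \<open>z\<close>, then the trajectory is trapped near \<open>z\<close>
  (\<open>converges_to_pulled_limit_point\<close>) by two Lyapunov functions that do not increase while \<open>y\<close> is
  close to \<open>z\<close>. One is \<open>V (y - z) + V y\<close>: its derivative is
  \<open>\<Sum>\<^sub>i (s\<^sub>i(z) - 2 s\<^sub>i(y)) y\<^sub>i'\<close>, and close to \<open>z\<close> each factor \<open>2 s\<^sub>i(y) - s\<^sub>i(z)\<close> has the same sign
  as \<open>s\<^sub>i(y)\<close>, be \<open>s\<^sub>i(z)\<close> zero or not. The other is \<open>V \<plusminus> \<eta> y\<^sub>l\<close> for \<open>\<eta> = \<bar>s\<^sub>l(z)\<bar> / 2\<close>: close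
  to \<open>z\<close> agent \<open>l\<close> is pulled by at least \<open>\<eta>\<close>, so each of its displacements is paid for by a
  decrease of \<open>V\<close>. As \<open>V y\<close> decreases to \<open>V z\<close>, these functions keep \<open>V (y - z)\<close> and \<open>\<bar>y\<^sub>l - z\<^sub>l\<bar>\<close>
  small, and on a connected graph these two numbers control the norm of \<open>y - z\<close>
  (\<open>norm_le_anchor_plus_disagreement\<close>).

  The bound on the limit uses the values of \<open>T\<close>: were \<open>\<bar>s\<^sub>i\<bar> > 2 d(i) w\<close> in the limit, the argument
  of \<open>T\<close> would eventually exceed the threshold by a fixed amount whatever the noise, so agent \<open>i\<close>
  would keep a velocity bounded away from zero, against boundedness.

  Trajectories are differentiable only almost everywhere, so each monotonicity statement rests on
  \<open>absolutely_continuous_nonincreasing\<close>, which asks for absolute continuity and for a one-sided bound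
  on the increments across almost every point. That form also applies to the maximum of the
  coordinates, which need not have a derivative.
\<close>

section \<open>Monotonicity of absolutely continuous functions\<close>

text \<open>Absolute continuity passes to Lipschitz functions of \<open>f\<close>; the term in \<open>v - u\<close> leaves room for
  adding a multiple of time, as in the proof of a growth rate.\<close>

lemma absolutely_continuous_fun_on_dominated:
  fixes f :: "real \<Rightarrow> 'a::real_normed_vector" and h :: "real \<Rightarrow> 'b::real_normed_vector"
  assumes f: "absolutely_continuous_fun_on S f"
    and dom: "\<And>u v. u \<in> S \<Longrightarrow> v \<in> S \<Longrightarrow> u \<le> v \<Longrightarrow>
                norm (h v - h u) \<le> B * norm (f v - f u) + C * (v - u)"
  shows "absolutely_continuous_fun_on S h"
  unfolding absolutely_continuous_fun_on_def
proof (intro allI impI)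
  fix \<epsilon> :: real
  assume "\<epsilon> > 0"
  define M where "M = \<bar>B\<bar> + \<bar>C\<bar> + 1"
  have M: "M > 0" "B \<le> M" "C \<le> M"
    by (auto simp: M_def)
  then have "\<epsilon> / (2 * M) > 0"
    using \<open>\<epsilon> > 0\<close> by simp
  then obtain \<delta> where "\<delta> > 0" and
    \<delta>: "\<And>F. finite F \<Longrightarrow> \<forall>(u, v)\<in>F. u \<le> v \<and> {u..v} \<subseteq> S \<Longrightarrow>
            disjoint_family_on (\<lambda>(u, v). {u<..<v}) F \<Longrightarrow>
            (\<Sum>(u, v)\<in>F. v - u) < \<delta> \<Longrightarrow> (\<Sum>(u, v)\<in>F. norm (f v - f u)) < \<epsilon> / (2 * M)"
    using f unfolding absolutely_continuous_fun_on_def by blast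
  show "\<exists>\<delta>>0. \<forall>F. finite F \<longrightarrow> (\<forall>(u, v)\<in>F. u \<le> v \<and> {u..v} \<subseteq> S) \<longrightarrow>
           disjoint_family_on (\<lambda>(u, v). {u<..<v}) F \<longrightarrow>
           (\<Sum>(u, v)\<in>F. v - u) < \<delta> \<longrightarrow> (\<Sum>(u, v)\<in>F. norm (h v - h u)) < \<epsilon>"
  proof (intro exI[of _ "min \<delta> (\<epsilon> / (2 * M))"] conjI allI impI)
    show "0 < min \<delta> (\<epsilon> / (2 * M))"
      using \<open>\<delta> > 0\<close> \<open>\<epsilon> / (2 * M) > 0\<close> by simp
  next
    fix F :: "(real \<times> real) set"
    assume F: "finite F" "\<forall>(u, v)\<in>F. u \<le> v \<and> {u..v} \<subseteq> S"
      "disjoint_family_on (\<lambda>(u, v). {u<..<v}) F"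
      and small: "(\<Sum>(u, v)\<in>F. v - u) < min \<delta> (\<epsilon> / (2 * M))"
    have "(\<Sum>(u, v)\<in>F. norm (h v - h u)) \<le> (\<Sum>(u, v)\<in>F. M * (norm (f v - f u) + (v - u)))"
    proof (rule sum_mono, clarify)
      fix u v
      assume "(u, v) \<in> F"
      then have "u \<le> v" "u \<in> S" "v \<in> S"
        using F(2) by force+
      then have "norm (h v - h u) \<le> B * norm (f v - f u) + C * (v - u)"
        using dom by blast
      also have "\<dots> \<le> M * norm (f v - f u) + M * (v - u)"
        using M \<open>u \<le> v\<close> by (intro add_mono mult_right_mono) auto
      finally show "norm (h v - h u) \<le> M * (norm (f v - f u) + (v - u))"
        by (simp add: algebra_simps)
    qed
    also have "\<dots> = M * ((\<Sum>(u, v)\<in>F. norm (f v - f u)) + (\<Sum>(u, v)\<in>F. v - u))"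
      by (simp add: sum_distrib_left sum.distrib[symmetric] case_prod_beta)
    also have "\<dots> < M * (\<epsilon> / (2 * M) + \<epsilon> / (2 * M))"
      using M small \<delta>[OF F] by (intro mult_strict_left_mono add_strict_mono) auto
    also have "\<dots> = \<epsilon>"
      using M by (simp add: field_simps)
    finally show "(\<Sum>(u, v)\<in>F. norm (h v - h u)) < \<epsilon>" .
  qed
qed

lemma absolutely_continuous_fun_on_imp_continuous_on:
  fixes f :: "real \<Rightarrow> 'a::real_normed_vector"
  assumes f: "absolutely_continuous_fun_on {a..b} f"
  shows "continuous_on {a..b} f"
  unfolding continuous_on_iff
proof (intro ballI allI impI)
  fix t \<epsilon> :: real
  assume t: "t \<in> {a..b}" and "\<epsilon> > 0"
  then obtain \<delta> where "\<delta> > 0" and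
    \<delta>: "\<And>F. finite F \<Longrightarrow> \<forall>(u, v)\<in>F. u \<le> v \<and> {u..v} \<subseteq> {a..b} \<Longrightarrow>
            disjoint_family_on (\<lambda>(u, v). {u<..<v}) F \<Longrightarrow>
            (\<Sum>(u, v)\<in>F. v - u) < \<delta> \<Longrightarrow> (\<Sum>(u, v)\<in>F. norm (f v - f u)) < \<epsilon>"
    using f unfolding absolutely_continuous_fun_on_def by blast
  have *: "norm (f v - f u) < \<epsilon>" if "u \<le> v" "a \<le> u" "v \<le> b" "v - u < \<delta>" for u v
    using \<delta>[of "{(u, v)}"] that by (auto simp: disjoint_family_on_def)
  show "\<exists>d>0. \<forall>s\<in>{a..b}. dist s t < d \<longrightarrow> dist (f s) (f t) < \<epsilon>"
  proof (intro exI[of _ \<delta>] conjI ballI impI)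
    fix s
    assume "s \<in> {a..b}" "dist s t < \<delta>"
    then show "dist (f s) (f t) < \<epsilon>"
      using *[of s t] *[of t s] t
      by (cases "s \<le> t") (auto simp: dist_norm norm_minus_commute)
  qed (fact \<open>\<delta> > 0\<close>)
qed

lemma sum_lengths_le_measure:
  fixes F :: "(real \<times> real) set"
  assumes F: "finite F" "\<And>u v. (u, v) \<in> F \<Longrightarrow> u \<le> v"
    and disj: "disjoint_family_on (\<lambda>(u, v). {u<..<v}) F"
    and sub: "\<And>u v. (u, v) \<in> F \<Longrightarrow> {u<..<v} \<subseteq> U" and U: "U \<in> lmeasurable"
  shows "(\<Sum>(u, v)\<in>F. v - u) \<le> measure lebesgue U"
proof -
  have "(\<Sum>(u, v)\<in>F. v - u) = (\<Sum>q\<in>F. measure lebesgue (case q of (u, v) \<Rightarrow> {u<..<v}))"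
    by (rule sum.cong) (use F(2) in auto)
  also have "\<dots> = measure lebesgue (\<Union>q\<in>F. case q of (u, v) \<Rightarrow> {u<..<v})"
    by (rule measure_finite_Union[symmetric]) (use F(1) disj in \<open>auto dest!: F(2) split: prod.splits\<close>)
  also have "\<dots> \<le> measure lebesgue U"
    by (rule measure_mono_fmeasurable) (use F(1) sub U in \<open>auto split: prod.splits\<close>)
  finally show ?thesis .
qed

text \<open>Cover the exceptional null set by an open set so small that, by absolute continuity, \<open>f\<close>
  increases by less than \<open>e\<close> in total over disjoint intervals inside it. By Cousin's lemma \<open>{a..b}\<close>
  splits into finitely many tagged intervals, each inside that set if its tag is exceptional and
  otherwise so short that \<open>f\<close> grows on it at rate at most \<open>e\<close>. Adding up,
  \<open>f b - f a \<le> e (1 + (b - a))\<close>. Only an upper bound on increments around each tag is assumed, since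
  it holds also for a maximum of functions that has no derivative there.\<close>

lemma absolutely_continuous_nonincreasing:
  fixes f :: "real \<Rightarrow> real"
  assumes "a \<le> b" and ac: "absolutely_continuous_fun_on {a..b} f" and N: "negligible N"
    and straddle: "\<And>t e. t \<in> {a..b} - N \<Longrightarrow> e > 0 \<Longrightarrow>
          \<exists>d>0. \<forall>u v. a \<le> u \<longrightarrow> u \<le> t \<longrightarrow> t \<le> v \<longrightarrow> v \<le> b \<longrightarrow> t - u < d \<longrightarrow> v - t < d \<longrightarrow>
             f v - f u \<le> e * (v - u)"
  shows "f b \<le> f a"
proof -
  have approx: "f b - f a \<le> e * (1 + (b - a))" if "e > 0" for e
  proof -
    obtain \<delta> where "\<delta> > 0" and
      \<delta>: "\<And>F. finite F \<Longrightarrow> \<forall>(u, v)\<in>F. u \<le> v \<and> {u..v} \<subseteq> {a..b} \<Longrightarrow>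
              disjoint_family_on (\<lambda>(u, v). {u<..<v}) F \<Longrightarrow>
              (\<Sum>(u, v)\<in>F. v - u) < \<delta> \<Longrightarrow> (\<Sum>(u, v)\<in>F. norm (f v - f u)) < e"
      using ac \<open>e > 0\<close> unfolding absolutely_continuous_fun_on_def by blast
    have Nnull: "N \<in> null_sets lebesgue"
      using N by (simp add: negligible_iff_null_sets)
    then obtain U where U: "open U" "N \<subseteq> U" "U - N \<in> lmeasurable"
      and Uless: "emeasure lebesgue (U - N) < ennreal \<delta>"
      using sets_lebesgue_outer_open[OF null_setsD2[OF Nnull] \<open>\<delta> > 0\<close>] by blast
    \<comment> \<open>The outer approximation bounds only the measure of \<open>U - N\<close>; as \<open>N\<close> is
      null, it bounds that of \<open>U\<close>.\<close>
    have UN: "U = (U - N) \<union> N"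
      using U(2) by blast
    have Umeas: "U \<in> lmeasurable"
      using UN U(3) Nnull N by (metis fmeasurable.Un negligible_imp_measurable)
    have "emeasure lebesgue U = emeasure lebesgue (U - N)"
      using Nnull U(1) by (metis borel_open emeasure_Diff_null_set sets_completionI_sets sets_lborel)
    then have Usmall: "measure lebesgue U < \<delta>"
      using Uless emeasure_eq_measure2[OF Umeas] by (metis ennreal_less_iff measure_nonneg)
    obtain r where r: "\<And>t. t \<in> {a..b} - N \<Longrightarrow> r t > 0"
      and rf: "\<And>t u v. t \<in> {a..b} - N \<Longrightarrow> a \<le> u \<Longrightarrow> u \<le> t \<Longrightarrow> t \<le> v \<Longrightarrow> v \<le> b \<Longrightarrow>
                 t - u < r t \<Longrightarrow> v - t < r t \<Longrightarrow> f v - f u \<le> e * (v - u)"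
      using straddle[OF _ \<open>e > 0\<close>] by metis
    define g where "g t = (if t \<in> N then U else if t \<in> {a..b} then ball t (r t) else ball t 1)" for t
    have "gauge g"
      unfolding gauge_def g_def using U r by auto
    then obtain P where P: "P tagged_division_of {a..b}" and fine: "g fine P"
      using fine_division_exists_real by blast
    have finP: "finite P"
      using P by blast
    \<comment> \<open>Degenerate intervals contribute nothing and are left out, because two of them with different
      tags can coincide, and then an interval would not determine its tag.\<close>
    define Q where "Q = {(t, K)\<in>P. t \<in> N \<and> Inf K < Sup K}"
    have Kform: "\<exists>u v. K = {u..v} \<and> u \<le> t \<and> t \<le> v \<and> a \<le> u \<and> v \<le> b \<and> Inf K = u \<and> Sup K = v \<and> K \<subseteq> g t \<and> t \<in> {a..b}"
      if in_P: "(t, K) \<in> P" for t K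
    proof -
      obtain u v where "K = cbox u v"
        using tagged_division_ofD(4)[OF P in_P] by blast
      then have K: "K = {u..v}"
        by simp
      have "t \<in> K" "K \<subseteq> {a..b}" "K \<subseteq> g t"
        using tagged_division_ofD[OF P] in_P fine by (auto simp: fine_def)
      then show ?thesis
        using K by (intro exI[of _ u] exI[of _ v]) (auto simp: subset_iff)
    qed
    define \<phi> :: "real \<times> real set \<Rightarrow> real \<times> real" where "\<phi> = (\<lambda>(t, K). (Inf K, Sup K))"
    have same: "q = q'" if q: "q \<in> Q" "q' \<in> Q" and meet: "{fst (\<phi> q)<..<snd (\<phi> q)} \<inter> {fst (\<phi> q')<..<snd (\<phi> q')} \<noteq> {}" for q q'
    proof (rule ccontr)
      assume "q \<noteq> q'"
      obtain t K t' K' where [simp]: "q = (t, K)" "q' = (t', K')"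
        by (metis surj_pair)
      have in_P: "(t, K) \<in> P" "(t', K') \<in> P"
        using q by (auto simp: Q_def)
      then have "interior K \<inter> interior K' = {}"
        using tagged_division_ofD(5)[OF P in_P] \<open>q \<noteq> q'\<close> by simp
      moreover have "interior K = {Inf K<..<Sup K}" "interior K' = {Inf K'<..<Sup K'}"
        using Kform[OF in_P(1)] Kform[OF in_P(2)] by (metis interior_atLeastAtMost_real)+
      ultimately show False
        using meet by (simp add: \<phi>_def)
    qed
    have inj: "inj_on \<phi> Q"
    proof (rule inj_onI)
      fix q q'
      assume q: "q \<in> Q" "q' \<in> Q" and eq: "\<phi> q = \<phi> q'"
      have "fst (\<phi> q) < snd (\<phi> q)"
        using q by (auto simp: Q_def \<phi>_def)
      then have "{fst (\<phi> q)<..<snd (\<phi> q)} \<noteq> {}"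
        by simp
      then show "q = q'"
        using same[OF q] eq by simp
    qed
    have disj: "disjoint_family_on (\<lambda>(u, v). {u<..<v}) (\<phi> ` Q)"
    proof (unfold disjoint_family_on_def, intro ballI impI)
      fix m n
      assume "m \<in> \<phi> ` Q" "n \<in> \<phi> ` Q" "m \<noteq> n"
      then show "(case m of (u, v) \<Rightarrow> {u<..<v}) \<inter> (case n of (u, v) \<Rightarrow> {u<..<v}) = {}"
        using same by (smt (verit, best) case_prod_beta image_iff)
    qed
    have Q_le: "(\<Sum>(t, K)\<in>Q. norm (f (Sup K) - f (Inf K))) < e"
    proof -
      have finF: "finite (\<phi> ` Q)"
        using finP by (auto simp: Q_def intro: finite_subset[of _ P])
      have F2: "\<forall>(u, v)\<in>\<phi> ` Q. u \<le> v \<and> {u..v} \<subseteq> {a..b}"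
        using Kform by (force simp: Q_def \<phi>_def)
      have "(\<Sum>(u, v)\<in>\<phi> ` Q. v - u) \<le> measure lebesgue U"
      proof (rule sum_lengths_le_measure[OF finF _ disj _ Umeas])
        fix u v
        assume "(u, v) \<in> \<phi> ` Q"
        then obtain t K where K: "(t, K) \<in> P" "t \<in> N" "u = Inf K" "v = Sup K"
          by (auto simp: Q_def \<phi>_def)
        then show "u \<le> v" "{u<..<v} \<subseteq> U"
          using Kform[OF K(1)] by (auto simp: g_def)
      qed
      then have "(\<Sum>(u, v)\<in>\<phi> ` Q. norm (f v - f u)) < e"
        using \<delta>[OF finF F2 disj] Usmall by linarith
      then show ?thesis
        unfolding sum.reindex[OF inj] by (simp add: \<phi>_def case_prod_beta)
    qed
    have "f b - f a = (\<Sum>(t, K)\<in>P. f (Sup K) - f (Inf K))"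
      using additive_tagged_division_1[OF \<open>a \<le> b\<close> P, of f] by simp
    also have "\<dots> \<le> (\<Sum>(t, K)\<in>P. (if (t, K) \<in> Q then norm (f (Sup K) - f (Inf K)) else 0)
                               + e * (Sup K - Inf K))"
    proof (rule sum_mono, clarify)
      fix t K
      assume in_P: "(t, K) \<in> P"
      obtain u v where K: "K = {u..v}" "u \<le> t" "t \<le> v" "a \<le> u" "v \<le> b" "Inf K = u" "Sup K = v"
        "K \<subseteq> g t" "t \<in> {a..b}"
        using Kform[OF in_P] by blast
      consider "(t, K) \<in> Q" | "u = v" | "t \<notin> N"
        using K in_P by (fastforce simp: Q_def)
      then show "f (Sup K) - f (Inf K) \<le>
          (if (t, K) \<in> Q then norm (f (Sup K) - f (Inf K)) else 0) + e * (Sup K - Inf K)"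
      proof cases
        case 1
        have "0 \<le> e * (v - u)"
          using K \<open>e > 0\<close> by simp
        then show ?thesis
          using 1 K by simp
      next
        case 2
        then show ?thesis
          using K by simp
      next
        case 3
        then have t: "t \<in> {a..b} - N"
          using K by simp
        have "u \<in> g t" "v \<in> g t"
          using K by auto
        then have "t - u < r t" "v - t < r t"
          using t by (auto simp: g_def dist_real_def)
        then have "f v - f u \<le> e * (v - u)"
          using rf[OF t] K by blast
        then show ?thesis
          using K 3 by (auto simp: Q_def)
      qed
    qed
    also have "\<dots> = (\<Sum>(t, K)\<in>Q. norm (f (Sup K) - f (Inf K))) + e * (\<Sum>(t, K)\<in>P. Sup K - Inf K)"
    proof -
      have "Q \<subseteq> P"
        by (auto simp: Q_def)
      then have "(\<Sum>(t, K)\<in>P. if (t, K) \<in> Q then norm (f (Sup K) - f (Inf K)) else 0)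
          = (\<Sum>(t, K)\<in>Q. norm (f (Sup K) - f (Inf K)))"
        using finP by (intro sum.mono_neutral_cong_right) auto
      then show ?thesis
        by (simp add: sum.distrib sum_distrib_left case_prod_beta)
    qed
    also have "(\<Sum>(t, K)\<in>P. Sup K - Inf K) = b - a"
      using additive_tagged_division_1[OF \<open>a \<le> b\<close> P, of "\<lambda>x. x"] by simp
    finally show ?thesis
      using Q_le by (simp add: algebra_simps)
  qed
  show ?thesis
  proof (rule ccontr)
    assume "\<not> f b \<le> f a"
    define L where "L = 1 + (b - a)"
    have "L > 0" "f b - f a > 0"
      using \<open>a \<le> b\<close> \<open>\<not> f b \<le> f a\<close> by (auto simp: L_def)
    then have "f b - f a \<le> (f b - f a) / (2 * L) * L"
      using approx[of "(f b - f a) / (2 * L)"] by (simp add: L_def)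
    also have "\<dots> = (f b - f a) / 2"
      using \<open>L > 0\<close> by simp
    finally show False
      using \<open>f b - f a > 0\<close> by simp
  qed
qed

text \<open>The points \<open>u\<close> and \<open>v\<close> enclose \<open>t\<close>, so the two error terms of the derivative at \<open>t\<close> add up to
  \<open>e (v - u)\<close>.\<close>

lemma straddle_nonpos_derivative:
  fixes h :: "real \<Rightarrow> real"
  assumes h: "(h has_real_derivative D) (at t within S)" and "D \<le> 0" and t: "t \<in> S" and "e > 0"
  shows "\<exists>d>0. \<forall>u v. u \<in> S \<longrightarrow> v \<in> S \<longrightarrow> u \<le> t \<longrightarrow> t \<le> v \<longrightarrow> t - u < d \<longrightarrow> v - t < d \<longrightarrow> h v - h u \<le> e * (v - u)"
proof -
  obtain d where "d > 0" and
    d: "\<And>s. s \<in> S \<Longrightarrow> \<bar>s - t\<bar> < d \<Longrightarrow> \<bar>h s - h t - D * (s - t)\<bar> \<le> e * \<bar>s - t\<bar>"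
    using h \<open>e > 0\<close> unfolding has_field_derivative_def has_derivative_within_alt real_norm_def by metis
  have "h v - h u \<le> e * (v - u)" if "u \<in> S" "v \<in> S" "u \<le> t" "t \<le> v" "t - u < d" "v - t < d" for u v
  proof -
    have "h v - h t \<le> D * (v - t) + e * (v - t)" "h t - h u \<le> D * (t - u) + e * (t - u)"
      using d[of v] d[of u] that by (auto simp: algebra_simps abs_le_iff)
    moreover have "D * (v - t) \<le> 0" "D * (t - u) \<le> 0"
      using \<open>D \<le> 0\<close> that by (auto simp: mult_nonpos_nonneg)
    ultimately show ?thesis
      by (simp add: algebra_simps)
  qed
  then show ?thesis
    using \<open>d > 0\<close> by blast
qed

text \<open>At a first time with \<open>g s \<ge> e\<close> there is equality by continuity, so \<open>g \<le> e\<close> up to and including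
  that time, and then \<open>step\<close> contradicts it.\<close>

lemma continuous_trapping:
  fixes g :: "real \<Rightarrow> real"
  assumes cont: "continuous_on {a..} g" and start: "g a < e"
    and step: "\<And>t. a \<le> t \<Longrightarrow> (\<And>s. s \<in> {a..t} \<Longrightarrow> g s \<le> e) \<Longrightarrow> g t < e"
    and "a \<le> t"
  shows "g t < e"
proof (rule ccontr)
  assume "\<not> g t < e"
  define S where "S = {s \<in> {a..t}. e \<le> g s}"
  have contt: "continuous_on {a..t} g"
    by (rule continuous_on_subset[OF cont]) auto
  have "closed S"
    unfolding S_def using continuous_closed_preimage[OF contt closed_atLeastAtMost closed_atLeast[of e]]
    by (simp add: vimage_def Int_def)
  moreover have "S \<noteq> {}" "bdd_below S"
    using \<open>\<not> g t < e\<close> \<open>a \<le> t\<close> by (auto simp: S_def intro: bdd_belowI[of _ a])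
  ultimately have first: "Inf S \<in> S" "\<And>s. s \<in> S \<Longrightarrow> Inf S \<le> s"
    by (auto intro: closed_contains_Inf cInf_lower)
  then have Inf_S: "a \<le> Inf S" "Inf S \<le> t" "e \<le> g (Inf S)"
    by (auto simp: S_def)
  have "continuous_on {a..Inf S} g"
    by (rule continuous_on_subset[OF cont]) auto
  then obtain s where "a \<le> s" "s \<le> Inf S" "g s = e"
    using IVT'[of g a e "Inf S"] start Inf_S by auto
  moreover from this have "Inf S \<le> s"
    using first(2)[of s] Inf_S by (simp add: S_def)
  ultimately have "g (Inf S) = e"
    by simp
  have "g s \<le> e" if s: "s \<in> {a..Inf S}" for s
  proof (cases "s = Inf S")
    case True
    then show ?thesis
      using \<open>g (Inf S) = e\<close> by simp
  next
    case False
    then have "s \<notin> S"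
      using first(2)[of s] s by auto
    then show ?thesis
      using s Inf_S(2) by (auto simp: S_def)
  qed
  then have "g (Inf S) < e"
    by (rule step[OF Inf_S(1)])
  then show False
    using Inf_S(3) by simp
qed

section \<open>The disagreement of a vector on a graph\<close>

text \<open>This is minus the graph Laplacian.\<close>

definition neighbour_pull :: "('n::finite \<times> 'n) set \<Rightarrow> real ^ 'n \<Rightarrow> 'n \<Rightarrow> real" where
  "neighbour_pull E a i = (\<Sum>j | (i, j) \<in> E. a $ j - a $ i)"

text \<open>The edge set contains both orientations of every edge, hence the factor \<open>1 / 4\<close>: this is
  half the quadratic form of the Laplacian, and its gradient is minus the pull.\<close>

definition disagreement :: "('n::finite \<times> 'n) set \<Rightarrow> real ^ 'n \<Rightarrow> real" where
  "disagreement E a = (\<Sum>(i, j)\<in>E. (a $ i - a $ j)\<^sup>2) / 4"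

lemma sum_edges_eq_sum_neighbours:
  fixes E :: "('n::finite \<times> 'n) set" and h :: "'n \<Rightarrow> 'n \<Rightarrow> real"
  shows "(\<Sum>(i, j)\<in>E. h i j) = (\<Sum>i\<in>UNIV. \<Sum>j | (i, j) \<in> E. h i j)"
proof -
  have "Sigma UNIV (\<lambda>i. {j. (i, j) \<in> E}) = E"
    by auto
  then show ?thesis
    using sum.Sigma[of UNIV "\<lambda>i. {j. (i, j) \<in> E}" h] by simp
qed

lemma sum_edges_swap:
  fixes h :: "'n::finite \<Rightarrow> 'n \<Rightarrow> real"
  assumes "sym E"
  shows "(\<Sum>(i, j)\<in>E. h i j) = (\<Sum>(i, j)\<in>E. h j i)"
  by (rule sum.reindex_bij_witness[of _ "\<lambda>(i, j). (j, i)" "\<lambda>(i, j). (j, i)"])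
    (use assms in \<open>auto dest: symD\<close>)

text \<open>Summation by parts: the Laplacian is symmetric, because the two orientations of an edge
  contribute equally.\<close>

lemma sum_edges_diff_mult_diff:
  fixes a b :: "real ^ 'n::finite"
  assumes "sym E"
  shows "(\<Sum>(i, j)\<in>E. (a $ i - a $ j) * (b $ i - b $ j)) = - 2 * (\<Sum>i\<in>UNIV. neighbour_pull E a i * b $ i)"
proof -
  have "(\<Sum>(i, j)\<in>E. (a $ i - a $ j) * (b $ i - b $ j))
      = (\<Sum>(i, j)\<in>E. (a $ i - a $ j) * b $ i) + (\<Sum>(i, j)\<in>E. (a $ j - a $ i) * b $ j)"
    by (simp add: sum.distrib[symmetric] case_prod_beta algebra_simps)
  also have "(\<Sum>(i, j)\<in>E. (a $ j - a $ i) * b $ j) = (\<Sum>(i, j)\<in>E. (a $ i - a $ j) * b $ i)"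
    by (rule sum_edges_swap[OF assms])
  also have "(\<Sum>(i, j)\<in>E. (a $ i - a $ j) * b $ i) = (\<Sum>i\<in>UNIV. - (neighbour_pull E a i * b $ i))"
    unfolding sum_edges_eq_sum_neighbours neighbour_pull_def sum_distrib_right sum_negf[symmetric]
    by (intro sum.cong refl) (simp add: algebra_simps)
  finally show ?thesis
    by (simp add: sum_negf)
qed

lemma disagreement_nonneg: "disagreement E a \<ge> 0"
  unfolding disagreement_def by (auto intro!: sum_nonneg)

text \<open>The second-order Taylor expansion at \<open>a\<close>, which is exact for a quadratic form. It shows that the
  disagreement relative to \<open>a\<close> differs from the disagreement itself by an affine function of \<open>b\<close>.\<close>

lemma disagreement_diff:
  fixes a b :: "real ^ 'n::finite"
  assumes "sym E"
  shows "disagreement E (b - a) = disagreement E b - disagreement E a + (\<Sum>i\<in>UNIV. neighbour_pull E a i * (b $ i - a $ i))"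
proof -
  have "(\<Sum>i\<in>UNIV. neighbour_pull E a i * (b $ i - a $ i))
      = - (\<Sum>(i, j)\<in>E. (a $ i - a $ j) * ((b - a) $ i - (b - a) $ j)) / 2"
    using sum_edges_diff_mult_diff[OF assms, of a "b - a"] by simp
  moreover have "(\<Sum>(i, j)\<in>E. ((b - a) $ i - (b - a) $ j)\<^sup>2) = (\<Sum>(i, j)\<in>E. (b $ i - b $ j)\<^sup>2)
      - (\<Sum>(i, j)\<in>E. (a $ i - a $ j)\<^sup>2) - 2 * (\<Sum>(i, j)\<in>E. (a $ i - a $ j) * ((b - a) $ i - (b - a) $ j))"
    by (simp add: sum_distrib_left sum_subtractf[symmetric] case_prod_beta power2_eq_square algebra_simps)
  ultimately show ?thesis
    unfolding disagreement_def by (simp add: field_simps)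
qed

lemma continuous_neighbour_pull: "continuous_on S (\<lambda>a. neighbour_pull E a i)"
  unfolding neighbour_pull_def
  by (intro continuous_on_sum continuous_on_diff continuous_on_component continuous_on_id)

lemma continuous_disagreement: "continuous_on S (disagreement E)"
proof -
  have "continuous_on S (\<lambda>a. (\<Sum>q\<in>E. (a $ fst q - a $ snd q)\<^sup>2) * (1 / 4))"
    by (intro continuous_on_mult_right continuous_on_sum continuous_on_power continuous_on_diff continuous_on_component continuous_on_id)
  then show ?thesis
    by (simp add: disagreement_def[abs_def] case_prod_beta)
qed

lemma abs_diff_le_sqrt_disagreement:
  fixes a :: "real ^ 'n::finite"
  assumes "(i, j) \<in> E"
  shows "\<bar>a $ i - a $ j\<bar> \<le> 2 * sqrt (disagreement E a)"
proof -
  have "(a $ i - a $ j)\<^sup>2 \<le> (\<Sum>(i, j)\<in>E. (a $ i - a $ j)\<^sup>2)"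
    using member_le_sum[OF assms, of "\<lambda>(i, j). (a $ i - a $ j)\<^sup>2"] by (auto simp: case_prod_beta)
  also have "\<dots> = (2 * sqrt (disagreement E a))\<^sup>2"
    using disagreement_nonneg[of E a] by (simp add: power_mult_distrib) (simp add: disagreement_def)
  finally have "\<bar>a $ i - a $ j\<bar> \<le> \<bar>2 * sqrt (disagreement E a)\<bar>"
    unfolding abs_le_square_iff .
  then show ?thesis
    using disagreement_nonneg[of E a] by simp
qed

text \<open>The disagreement bounds the difference across each edge, hence by adding along a path the
  difference between any entry and the entry at \<open>i\<close>. So a vector is small as soon as its
  disagreement and one single entry are.\<close>

lemma norm_le_anchor_plus_disagreement:
  fixes E :: "('n::finite \<times> 'n) set"
  assumes "connected_graph E"
  obtains C where "C \<ge> 0" "\<And>a. norm a \<le> C * (\<bar>a $ i\<bar> + sqrt (disagreement E a))"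
proof -
  have "\<exists>c\<ge>0. \<forall>a. \<bar>a $ i - a $ j\<bar> \<le> c * sqrt (disagreement E a)" if "(i, j) \<in> E\<^sup>*" for j
    using that
  proof (induction rule: rtrancl_induct)
    case base
    show ?case
      by (intro exI[of _ 0]) simp
  next
    case (step j l)
    then obtain c where c: "c \<ge> 0" "\<And>a. \<bar>a $ i - a $ j\<bar> \<le> c * sqrt (disagreement E a)"
      by blast
    have "\<bar>a $ i - a $ l\<bar> \<le> (c + 2) * sqrt (disagreement E a)" for a
      using c(2)[of a] abs_diff_le_sqrt_disagreement[OF step(2), of a] by (simp add: algebra_simps)
    then show ?case
      using c(1) by (intro exI[of _ "c + 2"]) auto
  qed
  then obtain c where c: "\<And>j. c j \<ge> 0" "\<And>j a. \<bar>a $ i - a $ j\<bar> \<le> c j * sqrt (disagreement E a)"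
    using assms unfolding connected_graph_def by metis
  define C where "C = (\<Sum>j\<in>UNIV. c j + 1)"
  have "norm a \<le> C * (\<bar>a $ i\<bar> + sqrt (disagreement E a))" for a
  proof -
    have "norm a \<le> (\<Sum>j\<in>UNIV. \<bar>a $ j\<bar>)"
      by (rule norm_le_l1_cart)
    also have "\<dots> \<le> (\<Sum>j\<in>UNIV. (c j + 1) * (\<bar>a $ i\<bar> + sqrt (disagreement E a)))"
    proof (rule sum_mono)
      fix j
      have "0 \<le> c j * \<bar>a $ i\<bar>" "0 \<le> sqrt (disagreement E a)"
        using c(1) disagreement_nonneg by auto
      moreover have "(c j + 1) * (\<bar>a $ i\<bar> + sqrt (disagreement E a))
          = c j * \<bar>a $ i\<bar> + c j * sqrt (disagreement E a) + \<bar>a $ i\<bar> + sqrt (disagreement E a)"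
        by (simp add: algebra_simps)
      ultimately show "\<bar>a $ j\<bar> \<le> (c j + 1) * (\<bar>a $ i\<bar> + sqrt (disagreement E a))"
        using c(2)[of a j] by linarith
    qed
    finally show ?thesis
      by (simp add: C_def sum_distrib_right)
  qed
  moreover have "C \<ge> 0"
    unfolding C_def using c(1) by (intro sum_nonneg) (simp add: add_nonneg_nonneg)
  ultimately show ?thesis
    using that by blast
qed

text \<open>By summation by parts of \<open>z\<close> with itself the disagreement vanishes, so \<open>z\<close> is constant along
  every edge.\<close>

lemma neighbour_pull_zero_imp_consensus:
  fixes z :: "real ^ 'n::finite"
  assumes "sym E" "connected_graph E" and pull: "\<And>i. neighbour_pull E z i = 0"
  shows "z $ i = z $ j"
proof -
  have "disagreement E z = 0"
    using sum_edges_diff_mult_diff[OF \<open>sym E\<close>, of z z] pull by (simp add: disagreement_def power2_eq_square)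
  then have edge: "z $ i = z $ j" if "(i, j) \<in> E" for i j
    using abs_diff_le_sqrt_disagreement[OF that, of z] by simp
  have "(i, j) \<in> E\<^sup>*"
    using assms(2) by (simp add: connected_graph_def)
  then show ?thesis
    by (induction rule: rtrancl_induct) (auto dest: edge)
qed

lemma neighbour_pull_uminus: "neighbour_pull E (- a) i = - neighbour_pull E a i"
  unfolding neighbour_pull_def sum_negf[symmetric] by (rule sum.cong) auto

text \<open>Local Lipschitz continuity is what makes the disagreement absolutely continuous along an
  absolutely continuous flow.\<close>

lemma disagreement_lipschitz_on_ball:
  assumes "norm a \<le> R" "norm b \<le> R"
  shows "\<bar>disagreement E b - disagreement E a\<bar> \<le> 2 * R * real (card E) * norm (b - a)"
proof -
  have "\<bar>(b $ i - b $ j)\<^sup>2 - (a $ i - a $ j)\<^sup>2\<bar> \<le> 8 * R * norm (b - a)" for i j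
  proof -
    have "\<bar>(b $ i - b $ j)\<^sup>2 - (a $ i - a $ j)\<^sup>2\<bar>
        = \<bar>(b - a) $ i - (b - a) $ j\<bar> * \<bar>(b $ i - b $ j) + (a $ i - a $ j)\<bar>"
      by (simp add: abs_mult[symmetric] power2_eq_square algebra_simps)
    also have "\<dots> \<le> (2 * norm (b - a)) * (4 * R)"
    proof (rule mult_mono)
      show "\<bar>(b - a) $ i - (b - a) $ j\<bar> \<le> 2 * norm (b - a)"
        using component_le_norm_cart[of "b - a" i] component_le_norm_cart[of "b - a" j] by linarith
      show "\<bar>(b $ i - b $ j) + (a $ i - a $ j)\<bar> \<le> 4 * R"
        using component_le_norm_cart[of a i] component_le_norm_cart[of a j]
          component_le_norm_cart[of b i] component_le_norm_cart[of b j] assms by linarith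
    qed auto
    finally show ?thesis
      by (simp add: mult_ac)
  qed
  then have "(\<Sum>(i, j)\<in>E. \<bar>(b $ i - b $ j)\<^sup>2 - (a $ i - a $ j)\<^sup>2\<bar>) \<le> real (card E) * (8 * R * norm (b - a))"
    by (intro sum_bounded_above) auto
  moreover have "\<bar>(\<Sum>(i, j)\<in>E. (b $ i - b $ j)\<^sup>2) - (\<Sum>(i, j)\<in>E. (a $ i - a $ j)\<^sup>2)\<bar>
      \<le> (\<Sum>(i, j)\<in>E. \<bar>(b $ i - b $ j)\<^sup>2 - (a $ i - a $ j)\<^sup>2\<bar>)"
    unfolding sum_subtractf[symmetric] case_prod_beta by (rule sum_abs)
  ultimately show ?thesis
    unfolding disagreement_def by (simp add: field_simps)
qed

section \<open>Flows in which agents only move towards their neighbours\<close>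

text \<open>The qualitative content of the control law: an agent moves only in the direction in which its
  neighbours pull it. The velocity \<open>y'\<close> is constrained in sign but not in size, and it is meaningful
  only off the null set \<open>N\<close>.\<close>

locale neighbour_driven_flow =
  fixes E :: "('n::finite \<times> 'n) set" and y :: "real \<Rightarrow> real ^ 'n"
    and y' :: "real \<Rightarrow> 'n \<Rightarrow> real" and N :: "real set"
  assumes sym_E: "sym E" and connected: "connected_graph E" and null: "negligible N"
    and ac: "0 \<le> a \<Longrightarrow> a \<le> b \<Longrightarrow> absolutely_continuous_fun_on {a..b} y"
    and deriv: "0 \<le> t \<Longrightarrow> t \<notin> N \<Longrightarrow> ((\<lambda>s. y s $ i) has_real_derivative y' t i) (at t within {0..})"
    and up: "0 \<le> t \<Longrightarrow> t \<notin> N \<Longrightarrow> y' t i > 0 \<Longrightarrow> neighbour_pull E (y t) i > 0"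
    and down: "0 \<le> t \<Longrightarrow> t \<notin> N \<Longrightarrow> y' t i < 0 \<Longrightarrow> neighbour_pull E (y t) i < 0"
begin

lemma continuous_flow: "continuous_on {0..} y"
  unfolding continuous_on_eq_continuous_within
proof
  fix t :: real
  assume "t \<in> {0..}"
  then have "continuous (at t within {0..t + 1}) y"
    using absolutely_continuous_fun_on_imp_continuous_on[OF ac[of 0 "t + 1"]]
    by (simp add: continuous_on_eq_continuous_within)
  moreover have "at t within {0..t + 1} = at t within {0..}"
    by (rule at_within_nhd[of _ "{..<t + 1}"]) auto
  ultimately show "continuous (at t within {0..}) y"
    by (simp add: continuous_within)
qed

lemma disagreement_has_derivative:
  assumes "0 \<le> t" "t \<notin> N"
  shows "((\<lambda>s. disagreement E (y s)) has_real_derivative - (\<Sum>i\<in>UNIV. neighbour_pull E (y t) i * y' t i)) (at t within {0..})"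
proof -
  have edge: "((\<lambda>s. (y s $ i - y s $ j)\<^sup>2) has_real_derivative
          2 * ((y t $ i - y t $ j) * (y' t i - y' t j))) (at t within {0..})" for i j
    using DERIV_power[OF DERIV_diff[OF deriv[OF assms, of i] deriv[OF assms, of j]], of 2] by (simp add: mult.commute)
  have "((\<lambda>s. disagreement E (y s)) has_real_derivative
          (\<Sum>(i, j)\<in>E. 2 * ((y t $ i - y t $ j) * (y' t i - y' t j))) / 4) (at t within {0..})"
    unfolding disagreement_def case_prod_beta
    by (intro DERIV_cdivide DERIV_sum edge)
  also have "(\<Sum>(i, j)\<in>E. 2 * ((y t $ i - y t $ j) * (y' t i - y' t j))) / 4 =
     (\<Sum>(i, j)\<in>E. (y t $ i - y t $ j) * ((\<chi> i. y' t i) $ i - (\<chi> i. y' t i) $ j)) / 2"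
    by (simp add: sum_distrib_left[symmetric] case_prod_beta)
  also have "\<dots> = - (\<Sum>i\<in>UNIV. neighbour_pull E (y t) i * y' t i)"
    unfolding sum_edges_diff_mult_diff[OF sym_E] by simp
  finally show ?thesis .
qed

text \<open>Every Lyapunov function below is a multiple of the disagreement plus a linear function. Its rate of
  change is the sum in \<open>rate\<close>, since the gradient of the disagreement is minus the pull.\<close>

lemma lyapunov_growth_le:
  assumes "0 \<le> a" "a \<le> b"
    and rate: "\<And>t. t \<in> {a..b} \<Longrightarrow> t \<notin> N \<Longrightarrow>
                 (\<Sum>i\<in>UNIV. (c i - \<alpha> * neighbour_pull E (y t) i) * y' t i) \<le> K"
  shows "\<alpha> * disagreement E (y b) + (\<Sum>i\<in>UNIV. c i * y b $ i)
      \<le> \<alpha> * disagreement E (y a) + (\<Sum>i\<in>UNIV. c i * y a $ i) + K * (b - a)"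
proof -
  define h where "h t = \<alpha> * disagreement E (y t) + (\<Sum>i\<in>UNIV. c i * y t $ i) - K * t" for t
  have "continuous_on {a..b} y"
    using ac assms(1,2) absolutely_continuous_fun_on_imp_continuous_on by blast
  then have "bounded (y ` {a..b})"
    by (intro compact_imp_bounded compact_continuous_image) auto
  then obtain R where "\<forall>z\<in>y ` {a..b}. norm z \<le> R"
    unfolding bounded_iff by blast
  then have R: "norm (y t) \<le> R" if "t \<in> {a..b}" for t
    using that by blast
  have "h b \<le> h a"
  proof (rule absolutely_continuous_nonincreasing[OF \<open>a \<le> b\<close> _ null])
    show "absolutely_continuous_fun_on {a..b} h"
    proof (rule absolutely_continuous_fun_on_dominated[OF ac[OF assms(1,2)]])
      fix u v
      assume uv: "u \<in> {a..b}" "v \<in> {a..b}" "u \<le> v"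
      have "\<bar>\<Sum>i\<in>UNIV. c i * (y v - y u) $ i\<bar> \<le> (\<Sum>i\<in>UNIV. \<bar>c i\<bar> * norm (y v - y u))"
      proof (rule order_trans[OF sum_abs sum_mono])
        show "\<bar>c i * (y v - y u) $ i\<bar> \<le> \<bar>c i\<bar> * norm (y v - y u)" for i
          unfolding abs_mult by (intro mult_left_mono component_le_norm_cart abs_ge_zero)
      qed
      then have 1: "\<bar>(\<Sum>i\<in>UNIV. c i * y v $ i) - (\<Sum>i\<in>UNIV. c i * y u $ i)\<bar> \<le> (\<Sum>i\<in>UNIV. \<bar>c i\<bar>) * norm (y v - y u)"
        by (simp only: sum_subtractf sum_distrib_right right_diff_distrib vector_minus_component)
      have 2: "\<bar>\<alpha> * (disagreement E (y v) - disagreement E (y u))\<bar>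
              \<le> \<bar>\<alpha>\<bar> * (2 * R * real (card E) * norm (y v - y u))"
        unfolding abs_mult using uv R by (intro mult_left_mono disagreement_lipschitz_on_ball) auto
      have 3: "\<bar>K * (v - u)\<bar> = \<bar>K\<bar> * (v - u)"
        using uv by (simp add: abs_mult)
      have "norm (h v - h u) \<le> \<bar>\<alpha> * (disagreement E (y v) - disagreement E (y u))\<bar>
          + \<bar>(\<Sum>i\<in>UNIV. c i * y v $ i) - (\<Sum>i\<in>UNIV. c i * y u $ i)\<bar> + \<bar>K * (v - u)\<bar>"
        unfolding h_def by (simp add: algebra_simps)
      then show "norm (h v - h u) \<le> (\<bar>\<alpha>\<bar> * (2 * R * real (card E)) + (\<Sum>i\<in>UNIV. \<bar>c i\<bar>)) * norm (y v - y u) + \<bar>K\<bar> * (v - u)"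
        using 1 2 3 by (simp add: algebra_simps)
    qed
  next
    fix t e :: real
    assume t: "t \<in> {a..b} - N" and "e > 0"
    then have t0: "0 \<le> t" "t \<notin> N"
      using \<open>0 \<le> a\<close> by auto
    have "(h has_real_derivative (\<alpha> * - (\<Sum>i\<in>UNIV. neighbour_pull E (y t) i * y' t i)
              + (\<Sum>i\<in>UNIV. c i * y' t i) - K * 1)) (at t within {0..})"
      unfolding h_def
      by (intro DERIV_diff DERIV_add DERIV_sum DERIV_cmult disagreement_has_derivative deriv t0 DERIV_ident)
    also have "\<alpha> * - (\<Sum>i\<in>UNIV. neighbour_pull E (y t) i * y' t i)
              + (\<Sum>i\<in>UNIV. c i * y' t i) - K * 1 = (\<Sum>i\<in>UNIV. (c i - \<alpha> * neighbour_pull E (y t) i) * y' t i) - K"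
      by (simp add: sum_distrib_left sum_subtractf left_diff_distrib mult.assoc)
    finally have h': "(h has_real_derivative (\<Sum>i\<in>UNIV. (c i - \<alpha> * neighbour_pull E (y t) i) * y' t i) - K)
        (at t within {0..})" .
    have "(\<Sum>i\<in>UNIV. (c i - \<alpha> * neighbour_pull E (y t) i) * y' t i) - K \<le> 0"
      using rate t by simp
    then obtain d where "d > 0" and d: "\<forall>u v. u \<in> {0..} \<longrightarrow> v \<in> {0..} \<longrightarrow> u \<le> t \<longrightarrow> t \<le> v \<longrightarrow>
        t - u < d \<longrightarrow> v - t < d \<longrightarrow> h v - h u \<le> e * (v - u)"
      using straddle_nonpos_derivative[OF h' _ _ \<open>e > 0\<close>] t0 by auto
    then show "\<exists>d>0. \<forall>u v. a \<le> u \<longrightarrow> u \<le> t \<longrightarrow> t \<le> v \<longrightarrow> v \<le> b \<longrightarrow> t - u < d \<longrightarrow> v - t < d \<longrightarrow>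
             h v - h u \<le> e * (v - u)"
      using \<open>0 \<le> a\<close> by (intro exI[of _ d]) auto
  qed
  then show ?thesis
    by (simp add: h_def algebra_simps)
qed

text \<open>An agent that attains the maximum is not pulled up and hence does not move up. The maximum of the
  coordinates is therefore nonincreasing, although several agents may exchange the leading role on a
  complicated set of times.\<close>

lemma stays_below:
  assumes "0 \<le> a" "a \<le> b" and bound: "\<And>j. y a $ j \<le> M"
  shows "y b $ i \<le> M"
proof -
  define m where "m t = (MAX j. y t $ j)" for t
  have m_ge: "y t $ j \<le> m t" for t j
    unfolding m_def by (rule Max_ge) auto
  have m_le: "m t \<le> r" if "\<And>j. y t $ j \<le> r" for t r
    unfolding m_def using that by (auto intro!: Max.boundedI)
  have m_attained: "\<exists>j. m t = y t $ j" for t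
  proof -
    have "m t \<in> range (\<lambda>j. y t $ j)"
      unfolding m_def by (rule Max_in) auto
    then show ?thesis
      by blast
  qed
  have "m b \<le> m a"
  proof (rule absolutely_continuous_nonincreasing[OF \<open>a \<le> b\<close> _ null])
    show "absolutely_continuous_fun_on {a..b} m"
    proof (rule absolutely_continuous_fun_on_dominated[OF ac[OF assms(1,2)]])
      fix u v :: real
      have one_sided: "m v \<le> m u + norm (y v - y u)" for u v
      proof (rule m_le)
        fix j
        show "y v $ j \<le> m u + norm (y v - y u)"
          using component_le_norm_cart[of "y v - y u" j] m_ge[of u j] by simp
      qed
      show "norm (m v - m u) \<le> 1 * norm (y v - y u) + 0 * (v - u)"
        using one_sided[of v u] one_sided[of u v] by (simp add: norm_minus_commute)
    qed
  next
    fix t e :: real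
    assume "t \<in> {a..b} - N" and "e > 0"
    then have t: "0 \<le> t" "t \<notin> N"
      using \<open>0 \<le> a\<close> by auto
    have leader: "\<exists>d>0. \<forall>u v. 0 \<le> u \<longrightarrow> u \<le> t \<longrightarrow> t \<le> v \<longrightarrow> t - u < d \<longrightarrow> v - t < d \<longrightarrow>
          y v $ j - y u $ j \<le> e * (v - u)" if "y t $ j = m t" for j
    proof -
      have "neighbour_pull E (y t) j \<le> 0"
        unfolding neighbour_pull_def using m_ge[of t] that by (intro sum_nonpos) simp
      then have "y' t j \<le> 0"
        using up[OF t, of j] by linarith
      then show ?thesis
        using straddle_nonpos_derivative[OF deriv[OF t, of j] _ _ \<open>e > 0\<close>] t by auto
    qed
    \<comment> \<open>To the right of \<open>t\<close> the agents maximal at \<open>t\<close> hardly rise, and the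
      others stay below the maximum by continuity. To the left a lower bound for the maximum is
      needed, and one agent maximal at \<open>t\<close> supplies it.\<close>
    have right: "\<exists>d>0. \<forall>v. t \<le> v \<longrightarrow> v - t < d \<longrightarrow> y v $ j \<le> m t + e * (v - t)" for j
    proof (cases "y t $ j = m t")
      case True
      then show ?thesis
        using leader[OF True] t by (metis add.commute diff_le_eq diff_self order_refl)
    next
      case False
      then have "m t - y t $ j > 0"
        using m_ge[of t j] by linarith
      then obtain d where "d > 0" and d: "\<And>v. v \<in> {0..} \<Longrightarrow> dist v t < d \<Longrightarrow> dist (y v) (y t) < m t - y t $ j"
        using continuous_flow t unfolding continuous_on_iff by (metis atLeast_iff)
      have "y v $ j \<le> m t + e * (v - t)" if v: "t \<le> v" "v - t < d" for v
      proof -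
        have "y v $ j - y t $ j < m t - y t $ j"
          using d[of v] component_le_norm_cart[of "y v - y t" j] v t by (auto simp: dist_norm)
        moreover have "0 \<le> e * (v - t)"
          using v \<open>e > 0\<close> by simp
        ultimately show ?thesis
          by linarith
      qed
      then show ?thesis
        using \<open>d > 0\<close> by blast
    qed
    then obtain d where d: "\<And>j. d j > 0" "\<And>j v. t \<le> v \<Longrightarrow> v - t < d j \<Longrightarrow> y v $ j \<le> m t + e * (v - t)"
      by metis
    obtain l where l: "y t $ l = m t"
      using m_attained by metis
    obtain d' where d': "d' > 0" "\<And>u. 0 \<le> u \<Longrightarrow> u \<le> t \<Longrightarrow> t - u < d' \<Longrightarrow> y t $ l - y u $ l \<le> e * (t - u)"
      using leader[OF l] by (metis diff_self order_refl)
    define r where "r = min d' (Min (range d))"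
    have "r > 0"
      unfolding r_def using d(1) d'(1) by (auto simp: Min_gr_iff)
    have r_le: "r \<le> d'" "r \<le> d j" for j
      unfolding r_def by (auto intro: min.coboundedI2)
    have "m v - m u \<le> e * (v - u)" if "a \<le> u" "u \<le> t" "t \<le> v" "t - u < r" "v - t < r" for u v
    proof -
      have "m v \<le> m t + e * (v - t)"
        using d(2)[OF \<open>t \<le> v\<close>] r_le(2) \<open>v - t < r\<close> by (intro m_le) (meson less_le_trans)
      moreover have "m t \<le> y u $ l + e * (t - u)"
        using d'(2)[of u] r_le(1) that \<open>0 \<le> a\<close> l by simp
      moreover have "y u $ l \<le> m u"
        by (rule m_ge)
      moreover have "e * (v - u) = e * (v - t) + e * (t - u)"
        by (simp add: algebra_simps)
      ultimately show ?thesis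
        by linarith
    qed
    then show "\<exists>d>0. \<forall>u v. a \<le> u \<longrightarrow> u \<le> t \<longrightarrow> t \<le> v \<longrightarrow> v \<le> b \<longrightarrow> t - u < d \<longrightarrow> v - t < d \<longrightarrow>
             m v - m u \<le> e * (v - u)"
      using \<open>r > 0\<close> by (intro exI[of _ r]) auto
  qed
  then show ?thesis
    using m_ge[of b i] m_le[OF bound] by linarith
qed


text \<open>The sign condition is symmetric, so each one-sided bound holds also in its mirror image.\<close>

lemma negated_flow: "neighbour_driven_flow E (\<lambda>t. - y t) (\<lambda>t i. - y' t i) N"
proof
  show "absolutely_continuous_fun_on {a..b} (\<lambda>t. - y t)" if "0 \<le> a" "a \<le> b" for a b
    by (rule absolutely_continuous_fun_on_dominated[OF ac[OF that], of _ 1 0])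
      (simp add: norm_minus_commute)
  show "((\<lambda>s. (- y s) $ i) has_real_derivative - y' t i) (at t within {0..})"
    if "0 \<le> t" "t \<notin> N" for t i
    using DERIV_minus[OF deriv[OF that, of i]] by simp
qed (use sym_E connected null up down in \<open>auto simp: neighbour_pull_uminus\<close>)

lemma stays_above:
  assumes "0 \<le> a" "a \<le> b" and "\<And>j. M \<le> y a $ j"
  shows "M \<le> y b $ i"
  using neighbour_driven_flow.stays_below[OF negated_flow assms(1,2), of "- M" i] assms(3) by simp

lemma pull_mult_velocity_nonneg: "0 \<le> t \<Longrightarrow> t \<notin> N \<Longrightarrow> 0 \<le> neighbour_pull E (y t) i * y' t i"
  using up[of t i] down[of t i] by (cases "y' t i" "0 :: real" rule: linorder_cases) (auto intro: mult_nonneg_nonneg mult_nonpos_nonpos)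

text \<open>Here the linear part is zero and the rate is minus the sum of the products of pull and velocity.\<close>

lemma disagreement_antimono:
  assumes "0 \<le> a" "a \<le> b"
  shows "disagreement E (y b) \<le> disagreement E (y a)"
proof -
  have "(\<Sum>i\<in>UNIV. (0 - 1 * neighbour_pull E (y t) i) * y' t i) \<le> 0" if "t \<in> {a..b}" "t \<notin> N" for t
    using pull_mult_velocity_nonneg[of t] that \<open>0 \<le> a\<close> by (intro sum_nonpos) simp
  then show ?thesis
    using lyapunov_growth_le[OF assms, of "\<lambda>_. 0" 1 0] by simp
qed

lemma flow_component_le: "0 \<le> t \<Longrightarrow> \<bar>y t $ i\<bar> \<le> norm (y 0)"
  using stays_below[of 0 t "norm (y 0)" i] stays_above[of 0 t "- norm (y 0)" i]
    component_le_norm_cart[of "y 0"] by (auto simp: abs_le_iff minus_le_iff)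

subsection \<open>Convergence\<close>

lemma limit_point_exists:
  obtains z where "\<And>e t. e > 0 \<Longrightarrow> \<exists>s\<ge>t. 0 \<le> s \<and> dist (y s) z < e"
proof -
  have "norm (y (real n)) \<le> real CARD('n) * norm (y 0)" for n
  proof -
    have "norm (y (real n)) \<le> (\<Sum>i\<in>UNIV. \<bar>y (real n) $ i\<bar>)"
      by (rule norm_le_l1_cart)
    also have "\<dots> \<le> of_nat CARD('n) * norm (y 0)"
      by (rule sum_bounded_above) (simp add: flow_component_le)
    finally show ?thesis .
  qed
  then have "bounded (range (\<lambda>n. y (real n)))"
    unfolding bounded_iff by blast
  then obtain z r where r: "strict_mono (r :: nat \<Rightarrow> nat)" and z: "((\<lambda>n. y (real n)) \<circ> r) \<longlonglongrightarrow> z"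
    using bounded_imp_convergent_subsequence by blast
  have "\<exists>s\<ge>t. 0 \<le> s \<and> dist (y s) z < e" if "e > 0" for e t
  proof -
    have "\<forall>\<^sub>F n in sequentially. dist (y (real (r n))) z < e"
      using tendstoD[OF z \<open>e > 0\<close>] by simp
    moreover have "\<forall>\<^sub>F n in sequentially. t \<le> real (r n)"
    proof -
      have "filterlim (\<lambda>n. real (r n)) at_top sequentially"
        using filterlim_compose[OF filterlim_real_sequentially filterlim_subseq[OF r]] by simp
      then show ?thesis
        by (simp add: filterlim_at_top)
    qed
    ultimately have "\<forall>\<^sub>F n in sequentially. t \<le> real (r n) \<and> dist (y (real (r n))) z < e"
      by (rule eventually_elim2) simp
    then obtain n where "t \<le> real (r n)" "dist (y (real (r n))) z < e"
      using eventually_happens trivial_limit_sequentially by blast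
    then show ?thesis
      by (intro exI[of _ "real (r n)"]) simp
  qed
  then show ?thesis
    using that by blast
qed

text \<open>By connectedness the entries of \<open>z\<close> are equal. Once all coordinates are close to that common value,
  the monotone minimum and maximum keep them there.\<close>

lemma converges_to_consensus:
  assumes near: "\<And>e t. e > 0 \<Longrightarrow> \<exists>s\<ge>t. 0 \<le> s \<and> dist (y s) z < e"
    and flat: "\<And>i. neighbour_pull E z i = 0"
  shows "(y \<longlongrightarrow> z) at_top"
proof (rule vec_tendstoI)
  fix i
  show "((\<lambda>t. y t $ i) \<longlongrightarrow> z $ i) at_top"
  proof (rule tendstoI)
    fix e :: real
    assume "e > 0"
    then obtain a where "0 \<le> a" "dist (y a) z < e / 2"
      using near[of "e / 2" 0] by auto
    then have start: "\<bar>y a $ j - z $ i\<bar> \<le> e / 2" for j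
      using component_le_norm_cart[of "y a - z" j]
        neighbour_pull_zero_imp_consensus[OF sym_E connected flat, of i j]
      by (simp add: dist_norm)
    have "dist (y t $ i) (z $ i) < e" if "a \<le> t" for t
    proof -
      have "y t $ i \<le> z $ i + e / 2"
        by (rule stays_below[OF \<open>0 \<le> a\<close> that]) (use start in \<open>smt (verit)\<close>)
      moreover have "z $ i - e / 2 \<le> y t $ i"
        by (rule stays_above[OF \<open>0 \<le> a\<close> that]) (use start in \<open>smt (verit)\<close>)
      ultimately show ?thesis
        using \<open>e > 0\<close> by (simp add: dist_real_def abs_less_iff)
    qed
    then show "\<forall>\<^sub>F t in at_top. dist (y t $ i) (z $ i) < e"
      unfolding eventually_at_top_linorder by blast
  qed
qed

text \<open>The hypothesis \<open>near\<close> says that \<open>z\<close> is a limit point of the trajectory. Agent \<open>l\<close> is pulled at \<open>z\<close>,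
  hence near \<open>z\<close> with strength at least \<open>\<eta>\<close>, and cannot move without lowering the disagreement, of
  which little is left to lose. Any other agent may move freely where its pull vanishes, but with agent \<open>l\<close>
  held in place the function \<open>disagreement E (y - z) + disagreement E y\<close> confines them all.\<close>

lemma converges_to_pulled_limit_point:
  assumes near: "\<And>e t. e > 0 \<Longrightarrow> \<exists>s\<ge>t. 0 \<le> s \<and> dist (y s) z < e"
    and pulled: "neighbour_pull E z l \<noteq> 0"
  shows "(y \<longlongrightarrow> z) at_top"
proof (rule tendstoI)
  fix e :: real
  assume "e > 0"
  have isCont_V: "isCont (disagreement E) z"
    using continuous_disagreement[of UNIV E] by (simp add: continuous_on_eq_continuous_at)
  have V_ge: "disagreement E z \<le> disagreement E (y t)" if "0 \<le> t" for t
  proof (rule ccontr)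
    assume "\<not> disagreement E z \<le> disagreement E (y t)"
    then have "\<forall>\<^sub>F a in nhds z. disagreement E (y t) < disagreement E a"
      using isCont_V by (intro order_tendstoD) (auto simp: continuous_at tendsto_nhds_iff)
    then obtain d where "d > 0" "\<And>a. dist a z < d \<Longrightarrow> disagreement E (y t) < disagreement E a"
      unfolding eventually_nhds_metric by blast
    moreover obtain s where "s \<ge> t" "dist (y s) z < d"
      using near[OF \<open>d > 0\<close>, of t] by blast
    ultimately show False
      using disagreement_antimono[OF \<open>0 \<le> t\<close> \<open>s \<ge> t\<close>] by force
  qed
  have "\<forall>\<^sub>F a in nhds z. \<forall>i. neighbour_pull E z i \<noteq> 0 \<longrightarrow>
          \<bar>neighbour_pull E a i - neighbour_pull E z i\<bar> < \<bar>neighbour_pull E z i\<bar> / 2"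
  proof (rule eventually_all_finite)
    fix i
    show "\<forall>\<^sub>F a in nhds z. neighbour_pull E z i \<noteq> 0 \<longrightarrow>
          \<bar>neighbour_pull E a i - neighbour_pull E z i\<bar> < \<bar>neighbour_pull E z i\<bar> / 2"
    proof (cases "neighbour_pull E z i = 0")
      case False
      have "isCont (\<lambda>a. neighbour_pull E a i) z"
        using continuous_neighbour_pull[of UNIV E i] by (simp add: continuous_on_eq_continuous_at)
      then have "((\<lambda>a. neighbour_pull E a i) \<longlongrightarrow> neighbour_pull E z i) (nhds z)"
        by (simp add: continuous_at tendsto_nhds_iff)
      then show ?thesis
        using tendstoD[of "\<lambda>a. neighbour_pull E a i" "neighbour_pull E z i" "nhds z" "\<bar>neighbour_pull E z i\<bar> / 2"] False
        by (simp add: dist_real_def)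
    qed simp
  qed
  then obtain r where "r > 0" and r: "\<And>a i. dist a z < r \<Longrightarrow> neighbour_pull E z i \<noteq> 0 \<Longrightarrow>
          \<bar>neighbour_pull E a i - neighbour_pull E z i\<bar> < \<bar>neighbour_pull E z i\<bar> / 2"
    unfolding eventually_nhds_metric by blast
  \<comment> \<open>Within distance \<open>r\<close> of \<open>z\<close> every pull that is nonzero at
    \<open>z\<close> keeps its sign and at least half its size; \<open>\<epsilon>\<close> lies
    strictly below \<open>r\<close> because the trapping argument allows distance equal to
    \<open>\<epsilon>\<close>.\<close>
  define \<epsilon> where "\<epsilon> = min e (r / 2)"
  have \<epsilon>: "\<epsilon> > 0" "\<epsilon> \<le> e" "\<epsilon> < r"
    using \<open>e > 0\<close> \<open>r > 0\<close> by (auto simp: \<epsilon>_def)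
  define \<eta> where "\<eta> = \<bar>neighbour_pull E z l\<bar> / 2"
  have "\<eta> > 0"
    using pulled by (simp add: \<eta>_def)
  obtain C where "C \<ge> 0" and C: "\<And>a. norm a \<le> C * (\<bar>a $ l\<bar> + sqrt (disagreement E a))"
    using norm_le_anchor_plus_disagreement[OF connected] by blast
  \<comment> \<open>If the trajectory starts \<open>\<kappa>\<close>-close to \<open>z\<close>, agent
    \<open>l\<close> stays within \<open>\<kappa> + \<kappa> / \<eta>\<close> of \<open>z\<close>
    and the disagreement relative to \<open>z\<close> is at most \<open>2 \<kappa>\<close>; the
    left-hand side is the resulting bound on the distance.\<close>
  have "\<exists>\<kappa>>0. C * (\<kappa> + \<kappa> / \<eta> + sqrt (2 * \<kappa>)) < \<epsilon>"
  proof -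
    have "((\<lambda>\<kappa>. C * (\<kappa> + \<kappa> / \<eta> + sqrt (2 * \<kappa>))) \<longlongrightarrow> C * (0 + 0 / \<eta> + sqrt (2 * 0))) (at_right 0)"
      using \<open>\<eta> > 0\<close> by (intro tendsto_intros) auto
    then have "\<forall>\<^sub>F \<kappa> in at_right 0. C * (\<kappa> + \<kappa> / \<eta> + sqrt (2 * \<kappa>)) < \<epsilon>"
      using \<epsilon>(1) by (intro order_tendstoD) auto
    then have "\<forall>\<^sub>F \<kappa> in at_right 0. \<kappa> > 0 \<and> C * (\<kappa> + \<kappa> / \<eta> + sqrt (2 * \<kappa>)) < \<epsilon>"
      using eventually_at_right_less by (rule eventually_elim2) simp
    then show ?thesis
      using eventually_happens trivial_limit_at_right_real by blast
  qed
  then obtain \<kappa> where "\<kappa> > 0" and \<kappa>: "C * (\<kappa> + \<kappa> / \<eta> + sqrt (2 * \<kappa>)) < \<epsilon>"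
    by blast
  have "\<forall>\<^sub>F a in nhds z. disagreement E (a - z) < \<kappa> \<and> disagreement E a < disagreement E z + \<kappa>"
  proof (rule eventually_conj)
    have "continuous_on UNIV (\<lambda>a. disagreement E (a - z))"
      by (rule continuous_on_compose2[OF continuous_disagreement[of UNIV]]) (auto intro!: continuous_intros)
    then have "isCont (\<lambda>a. disagreement E (a - z)) z"
      by (simp add: continuous_on_eq_continuous_at)
    then have "((\<lambda>a. disagreement E (a - z)) \<longlongrightarrow> disagreement E (z - z)) (nhds z)"
      by (simp add: continuous_at tendsto_nhds_iff)
    moreover have "disagreement E (z - z) = 0"
      by (simp add: disagreement_def case_prod_beta)
    ultimately show "\<forall>\<^sub>F a in nhds z. disagreement E (a - z) < \<kappa>"
      using \<open>\<kappa> > 0\<close> by (intro order_tendstoD) auto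
    show "\<forall>\<^sub>F a in nhds z. disagreement E a < disagreement E z + \<kappa>"
      using isCont_V \<open>\<kappa> > 0\<close> by (intro order_tendstoD) (auto simp: continuous_at tendsto_nhds_iff)
  qed
  then obtain d where "d > 0" and d: "\<And>a. dist a z < d \<Longrightarrow> disagreement E (a - z) < \<kappa>"
      "\<And>a. dist a z < d \<Longrightarrow> disagreement E a < disagreement E z + \<kappa>"
    unfolding eventually_nhds_metric by blast
  obtain a where "0 \<le> a" and a: "dist (y a) z < min d (min \<kappa> \<epsilon>)"
    using near[of "min d (min \<kappa> \<epsilon>)" 0] \<open>d > 0\<close> \<open>\<kappa> > 0\<close> \<epsilon> by auto
  have "dist (y t) z < \<epsilon>" if "a \<le> t" for t
  proof (rule continuous_trapping[OF _ _ _ that])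
    show "continuous_on {a..} (\<lambda>t. dist (y t) z)"
      using \<open>0 \<le> a\<close> by (intro continuous_intros continuous_on_subset[OF continuous_flow]) auto
    show "dist (y a) z < \<epsilon>"
      using a by simp
  next
    fix t
    assume "a \<le> t" and inside: "\<And>s. s \<in> {a..t} \<Longrightarrow> dist (y s) z \<le> \<epsilon>"
    have comparable: "\<bar>neighbour_pull E (y s) i - neighbour_pull E z i\<bar> < \<bar>neighbour_pull E z i\<bar> / 2"
      if "s \<in> {a..t}" "neighbour_pull E z i \<noteq> 0" for s i
      using r[of "y s" i] inside[OF that(1)] that(2) \<epsilon>(3) by simp
    \<comment> \<open>Up to the same constant the two sides are the values of \<open>disagreement E (y - z) +
      disagreement E y\<close> at the times \<open>t\<close> and \<open>a\<close>.\<close>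
    have total: "2 * disagreement E (y t) + (\<Sum>i\<in>UNIV. neighbour_pull E z i * y t $ i)
        \<le> 2 * disagreement E (y a) + (\<Sum>i\<in>UNIV. neighbour_pull E z i * y a $ i) + 0 * (t - a)"
    proof (rule lyapunov_growth_le[OF \<open>0 \<le> a\<close> \<open>a \<le> t\<close>])
      fix s
      assume s: "s \<in> {a..t}" "s \<notin> N"
      then have "0 \<le> s"
        using \<open>0 \<le> a\<close> by simp
      show "(\<Sum>i\<in>UNIV. (neighbour_pull E z i - 2 * neighbour_pull E (y s) i) * y' s i) \<le> 0"
      proof (rule sum_nonpos)
        fix i
        have *: "neighbour_pull E z i = 0 \<or>
            \<bar>neighbour_pull E (y s) i - neighbour_pull E z i\<bar> < \<bar>neighbour_pull E z i\<bar> / 2"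
          using comparable[OF s(1)] by blast
        show "(neighbour_pull E z i - 2 * neighbour_pull E (y s) i) * y' s i \<le> 0"
        proof (cases "y' s i" "0 :: real" rule: linorder_cases)
          case less
          then have "neighbour_pull E z i - 2 * neighbour_pull E (y s) i \<ge> 0"
            using down[OF \<open>0 \<le> s\<close> s(2)] * by (smt (verit) field_sum_of_halves)
          then show ?thesis
            using less by (simp add: mult_nonneg_nonpos)
        next
          case greater
          then have "neighbour_pull E z i - 2 * neighbour_pull E (y s) i \<le> 0"
            using up[OF \<open>0 \<le> s\<close> s(2)] * by (smt (verit) field_sum_of_halves)
          then show ?thesis
            using greater by (simp add: mult_nonpos_nonneg)
        qed simp
      qed
    qed
    \<comment> \<open>The two signs of \<open>\<sigma>\<close> bound the displacement of agent \<open>l\<close> in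
      both directions.\<close>
    have anchor: "disagreement E (y t) + \<sigma> * \<eta> * y t $ l \<le> disagreement E (y a) + \<sigma> * \<eta> * y a $ l"
      if \<sigma>: "\<bar>\<sigma>\<bar> = 1" for \<sigma> :: real
    proof -
      define c where "c i = (if i = l then \<sigma> * \<eta> else 0)" for i
      have c_sum: "(\<Sum>i\<in>UNIV. c i * v $ i) = \<sigma> * \<eta> * v $ l" for v :: "real ^ 'n"
        by (simp add: c_def if_distrib[of "\<lambda>b. b * _"] cong: if_cong)
      have "1 * disagreement E (y t) + (\<Sum>i\<in>UNIV. c i * y t $ i)
          \<le> 1 * disagreement E (y a) + (\<Sum>i\<in>UNIV. c i * y a $ i) + 0 * (t - a)"
      proof (rule lyapunov_growth_le[OF \<open>0 \<le> a\<close> \<open>a \<le> t\<close>])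
        fix s
        assume s: "s \<in> {a..t}" "s \<notin> N"
        then have "0 \<le> s"
          using \<open>0 \<le> a\<close> by simp
        show "(\<Sum>i\<in>UNIV. (c i - 1 * neighbour_pull E (y s) i) * y' s i) \<le> 0"
        proof (rule sum_nonpos)
          fix i
          show "(c i - 1 * neighbour_pull E (y s) i) * y' s i \<le> 0"
          proof (cases "i = l")
            case False
            then show ?thesis
              using pull_mult_velocity_nonneg[OF \<open>0 \<le> s\<close> s(2), of i] by (simp add: c_def)
          next
            case True
            have "\<bar>neighbour_pull E (y s) l\<bar> \<ge> \<eta>"
              using comparable[OF s(1) pulled] unfolding \<eta>_def by linarith
            moreover have "\<bar>\<sigma> * \<eta>\<bar> = \<eta>"
              using \<sigma> \<open>\<eta> > 0\<close> by (simp add: abs_mult)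
            ultimately show ?thesis
              using up[OF \<open>0 \<le> s\<close> s(2), of l] down[OF \<open>0 \<le> s\<close> s(2), of l] True
              by (cases "y' s l" "0 :: real" rule: linorder_cases)
                (auto simp: c_def mult_le_0_iff)
          qed
        qed
      qed
      then show ?thesis
        by (simp add: c_sum)
    qed
    have "0 \<le> t"
      using \<open>0 \<le> a\<close> \<open>a \<le> t\<close> by simp
    have small: "disagreement E (y a - z) < \<kappa>" "disagreement E (y a) < disagreement E z + \<kappa>" "\<bar>y a $ l - z $ l\<bar> < \<kappa>"
      using d[of "y a"] a component_le_norm_cart[of "y a - z" l] by (auto simp: dist_norm)
    have "disagreement E (y t - z) + disagreement E (y t) \<le> disagreement E (y a - z) + disagreement E (y a)"
      using total unfolding disagreement_diff[OF sym_E] by (simp add: right_diff_distrib sum_subtractf)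
    then have "disagreement E (y t - z) \<le> 2 * \<kappa>"
      using small V_ge[OF \<open>0 \<le> t\<close>] by linarith
    moreover have "\<bar>(y t - z) $ l\<bar> \<le> \<kappa> + \<kappa> / \<eta>"
    proof -
      have "\<eta> * (y t $ l - y a $ l) \<le> \<kappa>" "\<eta> * (y a $ l - y t $ l) \<le> \<kappa>"
        using anchor[of 1] anchor[of "-1"] small V_ge[OF \<open>0 \<le> t\<close>] by (auto simp: algebra_simps)
      then have "y t $ l - y a $ l \<le> \<kappa> / \<eta>" "y a $ l - y t $ l \<le> \<kappa> / \<eta>"
        using \<open>\<eta> > 0\<close> by (auto simp: pos_le_divide_eq mult.commute)
      then show ?thesis
        using small by (simp add: abs_le_iff abs_less_iff)
    qed
    ultimately have "C * (\<bar>(y t - z) $ l\<bar> + sqrt (disagreement E (y t - z))) \<le> C * (\<kappa> + \<kappa> / \<eta> + sqrt (2 * \<kappa>))"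
      using \<open>C \<ge> 0\<close> by (intro mult_left_mono add_mono) auto
    then show "dist (y t) z < \<epsilon>"
      using C[of "y t - z"] \<kappa> unfolding dist_norm by linarith
  qed
  then show "\<forall>\<^sub>F t in at_top. dist (y t) z < e"
    unfolding eventually_at_top_linorder using \<epsilon>(2) by (meson less_le_trans)
qed

theorem flow_converges: "\<exists>z. (y \<longlongrightarrow> z) at_top"
proof -
  obtain z where near: "\<And>e t. e > 0 \<Longrightarrow> \<exists>s\<ge>t. 0 \<le> s \<and> dist (y s) z < e"
    using limit_point_exists by blast
  show ?thesis
    using converges_to_consensus[OF near] converges_to_pulled_limit_point[OF near] by blast
qed

text \<open>Otherwise the coordinate would grow at least linearly and leave the bounds set by the initial
  state.\<close>

lemma velocity_not_always_ge:
  assumes "c > 0" "0 \<le> a"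
  shows "\<exists>t\<ge>a. t \<notin> N \<and> y' t i < c"
proof (rule ccontr)
  assume contra: "\<not> ?thesis"
  \<comment> \<open>Coordinates lie between \<open>- norm (y 0)\<close> and \<open>norm (y 0)\<close>, and by time
    \<open>b\<close> the climb would exceed the length of that interval.\<close>
  define b where "b = a + (2 * norm (y 0) + 1) / c"
  have "a \<le> b"
    using \<open>c > 0\<close> by (simp add: b_def)
  define \<gamma> :: "'n \<Rightarrow> real" where "\<gamma> j = (if j = i then -1 else 0)" for j
  have \<gamma>_sum: "(\<Sum>j\<in>UNIV. \<gamma> j * v j) = - v i" for v :: "'n \<Rightarrow> real"
    by (simp add: \<gamma>_def if_distrib[of "\<lambda>b. b * _"] cong: if_cong)
  have "0 * disagreement E (y b) + (\<Sum>j\<in>UNIV. \<gamma> j * y b $ j)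
      \<le> 0 * disagreement E (y a) + (\<Sum>j\<in>UNIV. \<gamma> j * y a $ j) + (- c) * (b - a)"
  proof (rule lyapunov_growth_le[OF \<open>0 \<le> a\<close> \<open>a \<le> b\<close>])
    fix t
    assume "t \<in> {a..b}" "t \<notin> N"
    then have "y' t i \<ge> c"
      using contra by force
    then show "(\<Sum>j\<in>UNIV. (\<gamma> j - 0 * neighbour_pull E (y t) j) * y' t j) \<le> - c"
      by (simp add: \<gamma>_sum)
  qed
  then have "y a $ i + (2 * norm (y 0) + 1) \<le> y b $ i"
    using \<open>c > 0\<close> by (simp add: \<gamma>_sum b_def)
  then show False
    using flow_component_le[of a i] flow_component_le[of b i] \<open>0 \<le> a\<close> \<open>a \<le> b\<close>
    by (auto simp: abs_le_iff)
qed

lemma velocity_not_always_le: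
  assumes "c > 0" "0 \<le> a"
  shows "\<exists>t\<ge>a. t \<notin> N \<and> - c < y' t i"
  using neighbour_driven_flow.velocity_not_always_ge[OF negated_flow assms, of i] by (simp add: minus_less_iff)

end

section \<open>The noisy control law\<close>

lemma deadzone_family_pos:
  assumes T: "deadzone_family T" and "0 \<le> c" "c < u"
  shows "0 < T c u"
proof -
  have "mono (T c)" and zero: "\<And>v. T c v = 0 \<longleftrightarrow> \<bar>v\<bar> \<le> c"
    using T \<open>0 \<le> c\<close> by (auto simp: deadzone_family_def)
  then have "T c 0 \<le> T c u"
    using assms by (auto intro: monoD)
  moreover have "T c 0 = 0" "T c u \<noteq> 0"
    using assms by (simp_all add: zero)
  ultimately show ?thesis
    by simp
qed

lemma deadzone_family_neg:
  assumes T: "deadzone_family T" and "0 \<le> c" "u < - c"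
  shows "T c u < 0"
proof -
  have "mono (T c)" and zero: "\<And>v. T c v = 0 \<longleftrightarrow> \<bar>v\<bar> \<le> c"
    using T \<open>0 \<le> c\<close> by (auto simp: deadzone_family_def)
  then have "T c u \<le> T c 0"
    using assms by (auto intro: monoD)
  moreover have "T c 0 = 0" "T c u \<noteq> 0"
    using assms by (simp_all add: zero)
  ultimately show ?thesis
    by simp
qed

text \<open>After subtracting the realizing positions, the measured sum of agent \<open>i\<close> is its pull plus the
  sum of its \<open>d(i)\<close> disturbances, whose size is at most the threshold. So that sum can leave
  the dead zone only on the side of the pull.\<close>

lemma control_law_neighbour_driven_flow:
  fixes E :: "('n::finite \<times> 'n) set" and x :: "real \<Rightarrow> real ^ 'n"
  assumes "sym E" "connected_graph E" "0 \<le> wbar" "0 < k"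
    and noise: "\<And>i j t. (i, j) \<in> E \<Longrightarrow> t \<ge> 0 \<Longrightarrow> \<bar>w j i t\<bar> \<le> wbar"
    and D: "\<And>i j. (i, j) \<in> E \<Longrightarrow> D j i = p j - p i"
    and T: "deadzone_family T"
    and law: "evolves_under_control_law E k T wbar D w x"
  obtains v N where "neighbour_driven_flow E (\<lambda>t. x t - (\<chi> i. p i)) v N"
    and "\<And>t i. 0 \<le> t \<Longrightarrow> t \<notin> N \<Longrightarrow> \<exists>n. \<bar>n\<bar> \<le> real (graph_degree E i) * wbar \<and>
           v t i = k * T (real (graph_degree E i) * wbar) (neighbour_pull E (x t - (\<chi> i. p i)) i + n)"
proof -
  define y where "y t = x t - (\<chi> i. p i)" for t
  define c where "c i = real (graph_degree E i) * wbar" for i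
  define v where
    "v t i = k * T (c i) (\<Sum>j | (i, j) \<in> E. measured_displacement w x j i t - D j i)" for t i
  have c_nonneg: "0 \<le> c i" for i
    using \<open>0 \<le> wbar\<close> by (simp add: c_def)
  have "AE t in lebesgue_on {0..}. \<forall>i. ((\<lambda>s. x s $ i) has_real_derivative v t i) (at t within {0..})"
    using law by (simp add: evolves_under_control_law_def v_def c_def)
  then have "AE t in lebesgue. t \<in> {0..} \<longrightarrow>
      (\<forall>i. ((\<lambda>s. x s $ i) has_real_derivative v t i) (at t within {0..}))"
    by (subst (asm) AE_restrict_space_iff) auto
  then obtain N where "N \<in> null_sets lebesgue" and N: "{t. \<not> (t \<in> {0..} \<longrightarrow>
      (\<forall>i. ((\<lambda>s. x s $ i) has_real_derivative v t i) (at t within {0..})))} \<subseteq> N"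
    unfolding eventually_ae_filter by auto
  have speed: "\<exists>n. \<bar>n\<bar> \<le> c i \<and> v t i = k * T (c i) (neighbour_pull E (y t) i + n)" if "0 \<le> t" for t i
  proof (intro exI conjI)
    have "\<bar>\<Sum>j | (i, j) \<in> E. w j i t\<bar> \<le> (\<Sum>j | (i, j) \<in> E. \<bar>w j i t\<bar>)"
      by (rule sum_abs)
    also have "\<dots> \<le> real (card {j. (i, j) \<in> E}) * wbar"
      by (rule sum_bounded_above) (use noise that in auto)
    finally show "\<bar>\<Sum>j | (i, j) \<in> E. w j i t\<bar> \<le> c i"
      by (simp add: c_def graph_degree_def)
    have "(\<Sum>j | (i, j) \<in> E. measured_displacement w x j i t - D j i)
        = (\<Sum>j | (i, j) \<in> E. (y t $ j - y t $ i) + w j i t)"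
      by (rule sum.cong) (auto simp: measured_displacement_def D y_def)
    then show "v t i = k * T (c i) (neighbour_pull E (y t) i + (\<Sum>j | (i, j) \<in> E. w j i t))"
      by (simp add: v_def neighbour_pull_def sum.distrib)
  qed
  have "neighbour_driven_flow E y v N"
  proof
    show "negligible N"
      using \<open>N \<in> null_sets lebesgue\<close> by (simp add: negligible_iff_null_sets)
    show "absolutely_continuous_fun_on {a..b} y" if "0 \<le> a" "a \<le> b" for a b
      by (rule absolutely_continuous_fun_on_dominated[where f = x and B = 1 and C = 0])
        (use law that in \<open>auto simp: evolves_under_control_law_def y_def\<close>)
    show "((\<lambda>s. y s $ i) has_real_derivative v t i) (at t within {0..})" if "0 \<le> t" "t \<notin> N" for t i
    proof -
      have "((\<lambda>s. x s $ i) has_real_derivative v t i) (at t within {0..})"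
        using N that by auto
      from DERIV_diff[OF this DERIV_const[of "p i"]] show ?thesis
        by (simp add: y_def)
    qed
    show "0 < neighbour_pull E (y t) i" if "0 \<le> t" "0 < v t i" for t i
    proof (rule ccontr)
      assume "\<not> 0 < neighbour_pull E (y t) i"
      moreover obtain n where n: "\<bar>n\<bar> \<le> c i" "v t i = k * T (c i) (neighbour_pull E (y t) i + n)"
        using speed[OF \<open>0 \<le> t\<close>] by blast
      ultimately have "neighbour_pull E (y t) i + n < - c i \<or> \<bar>neighbour_pull E (y t) i + n\<bar> \<le> c i"
        by linarith
      then have "T (c i) (neighbour_pull E (y t) i + n) \<le> 0"
        using deadzone_family_neg[OF T c_nonneg] T c_nonneg[of i]
        unfolding deadzone_family_def by (metis order.refl order.strict_implies_order)
      then show False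
        using that n \<open>0 < k\<close> by (simp add: zero_less_mult_iff)
    qed
    show "neighbour_pull E (y t) i < 0" if "0 \<le> t" "v t i < 0" for t i
    proof (rule ccontr)
      assume "\<not> neighbour_pull E (y t) i < 0"
      moreover obtain n where n: "\<bar>n\<bar> \<le> c i" "v t i = k * T (c i) (neighbour_pull E (y t) i + n)"
        using speed[OF \<open>0 \<le> t\<close>] by blast
      ultimately have "c i < neighbour_pull E (y t) i + n \<or> \<bar>neighbour_pull E (y t) i + n\<bar> \<le> c i"
        by linarith
      then have "0 \<le> T (c i) (neighbour_pull E (y t) i + n)"
        using deadzone_family_pos[OF T c_nonneg] T c_nonneg[of i]
        unfolding deadzone_family_def by (metis order.refl order.strict_implies_order)
      then show False
        using that n \<open>0 < k\<close> by (simp add: mult_less_0_iff)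
    qed
  qed (use assms in auto)
  then show ?thesis
    using that speed unfolding y_def c_def by blast
qed

theorem theorem5:
  fixes E :: "('n::finite \<times> 'n) set"
    and wbar k :: real
    and w :: "'n \<Rightarrow> 'n \<Rightarrow> real \<Rightarrow> real"
    and D :: "'n \<Rightarrow> 'n \<Rightarrow> real"
    and p :: "'n \<Rightarrow> real"
    and T :: "real \<Rightarrow> real \<Rightarrow> real"
    and x :: "real \<Rightarrow> real ^ 'n"
  assumes "undirected_graph E" and "connected_graph E"
    and "wbar > 0" and "k > 0"
    and "\<And>i j. (i, j) \<in> E \<Longrightarrow> w j i \<in> borel_measurable (lebesgue_on {0..})"
    and "\<And>i j t. (i, j) \<in> E \<Longrightarrow> t \<ge> 0 \<Longrightarrow> \<bar>w j i t\<bar> \<le> wbar"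
    and "\<And>i j. (i, j) \<in> E \<Longrightarrow> D j i = p j - p i"
    and "deadzone_family T"
    and "evolves_under_control_law E k T wbar D w x"
  shows "(\<exists>xs. (x \<longlongrightarrow> xs) at_top \<and>
            (\<forall>i. \<bar>\<Sum>j | (i, j) \<in> E. xs $ j - xs $ i - D j i\<bar> \<le> 2 * real (graph_degree E i) * wbar)) \<and>
         (\<forall>i. \<forall>t\<ge>0. p i + (MIN j. x 0 $ j - p j) \<le> x t $ i \<and>
                     x t $ i \<le> p i + (MAX j. x 0 $ j - p j))"
proof -
  have "sym E"
    using assms(1) by (simp add: undirected_graph_def)
  obtain v N where flow: "neighbour_driven_flow E (\<lambda>t. x t - (\<chi> i. p i)) v N"
    and speed: "\<And>t i. 0 \<le> t \<Longrightarrow> t \<notin> N \<Longrightarrow> \<exists>n. \<bar>n\<bar> \<le> real (graph_degree E i) * wbar \<and>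
           v t i = k * T (real (graph_degree E i) * wbar) (neighbour_pull E (x t - (\<chi> i. p i)) i + n)"
    using control_law_neighbour_driven_flow[of E wbar k w D p T x] assms \<open>sym E\<close> by (auto simp: less_imp_le)
  interpret neighbour_driven_flow E "\<lambda>t. x t - (\<chi> i. p i)" v N
    by (fact flow)
  obtain z where z: "((\<lambda>t. x t - (\<chi> i. p i)) \<longlongrightarrow> z) at_top"
    using flow_converges by blast
  have limit_bound: "\<bar>neighbour_pull E z i\<bar> \<le> 2 * real (graph_degree E i) * wbar" for i
  proof (rule ccontr)
    define c where "c = real (graph_degree E i) * wbar"
    have c: "0 \<le> c"
      using \<open>wbar > 0\<close> by (simp add: c_def)
    have mono_T: "mono (T c)"
      using assms(8) c by (simp add: deadzone_family_def)
    assume "\<not> \<bar>neighbour_pull E z i\<bar> \<le> 2 * real (graph_degree E i) * wbar"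
    then have large: "\<bar>neighbour_pull E z i\<bar> > 2 * c"
      by (simp add: c_def)
    \<comment> \<open>Half of the excess absorbs the distance of the pull from its limit, and the other half keeps the
      argument of \<open>T\<close> beyond the threshold.\<close>
    define \<delta> where "\<delta> = (\<bar>neighbour_pull E z i\<bar> - 2 * c) / 2"
    have "\<delta> > 0" and z_eq: "\<bar>neighbour_pull E z i\<bar> = 2 * c + 2 * \<delta>"
      using large by (auto simp: \<delta>_def field_simps)
    have "isCont (\<lambda>a. neighbour_pull E a i) z"
      using continuous_neighbour_pull[of UNIV E i] by (simp add: continuous_on_eq_continuous_at)
    then have "((\<lambda>t. neighbour_pull E (x t - (\<chi> i. p i)) i) \<longlongrightarrow> neighbour_pull E z i) at_top"
      using z by (rule isCont_tendsto_compose)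
    then have "\<forall>\<^sub>F t in at_top. dist (neighbour_pull E (x t - (\<chi> i. p i)) i) (neighbour_pull E z i) < \<delta>"
      using \<open>\<delta> > 0\<close> by (rule tendstoD)
    then obtain a0 where a0: "\<And>t. a0 \<le> t \<Longrightarrow>
        \<bar>neighbour_pull E (x t - (\<chi> i. p i)) i - neighbour_pull E z i\<bar> < \<delta>"
      unfolding eventually_at_top_linorder dist_real_def by blast
    define a where "a = max a0 0"
    show False
    proof (cases "neighbour_pull E z i > 0")
      case True
      have "0 < k * T c (c + \<delta>)"
        using deadzone_family_pos[OF assms(8) c, of "c + \<delta>"] \<open>\<delta> > 0\<close> \<open>k > 0\<close> by simp
      then obtain t where t: "a \<le> t" "t \<notin> N" "v t i < k * T c (c + \<delta>)"
        using velocity_not_always_ge[of "k * T c (c + \<delta>)" a i] by (auto simp: a_def)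
      then obtain n where n: "\<bar>n\<bar> \<le> c" "v t i = k * T c (neighbour_pull E (x t - (\<chi> i. p i)) i + n)"
        using speed[of t i] by (auto simp: a_def c_def)
      have "c + \<delta> \<le> neighbour_pull E (x t - (\<chi> i. p i)) i + n"
        using a0[of t] t(1) n(1) z_eq True by (simp add: a_def abs_less_iff abs_le_iff)
      then have "k * T c (c + \<delta>) \<le> v t i"
        unfolding n(2) using monoD[OF mono_T] \<open>k > 0\<close> by simp
      then show False
        using t(3) by simp
    next
      case False
      have "0 < - (k * T c (- (c + \<delta>)))"
        using deadzone_family_neg[OF assms(8) c, of "- (c + \<delta>)"] \<open>\<delta> > 0\<close> \<open>k > 0\<close>
        by (simp add: mult_less_0_iff)
      then obtain t where t: "a \<le> t" "t \<notin> N" "k * T c (- (c + \<delta>)) < v t i"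
        using velocity_not_always_le[of "- (k * T c (- (c + \<delta>)))" a i] by (auto simp: a_def)
      then obtain n where n: "\<bar>n\<bar> \<le> c" "v t i = k * T c (neighbour_pull E (x t - (\<chi> i. p i)) i + n)"
        using speed[of t i] by (auto simp: a_def c_def)
      have "neighbour_pull E (x t - (\<chi> i. p i)) i + n \<le> - (c + \<delta>)"
        using a0[of t] t(1) n(1) z_eq False by (simp add: a_def abs_less_iff abs_le_iff)
      then have "v t i \<le> k * T c (- (c + \<delta>))"
        unfolding n(2) using monoD[OF mono_T] \<open>k > 0\<close> by simp
      then show False
        using t(3) by simp
    qed
  qed
  have "\<exists>xs. (x \<longlongrightarrow> xs) at_top \<and>
      (\<forall>i. \<bar>\<Sum>j | (i, j) \<in> E. xs $ j - xs $ i - D j i\<bar> \<le> 2 * real (graph_degree E i) * wbar)"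
  proof (intro exI conjI allI)
    show "(x \<longlongrightarrow> z + (\<chi> i. p i)) at_top"
      using tendsto_add[OF z tendsto_const[of "\<chi> i. p i"]] by simp
    fix i
    have "(\<Sum>j | (i, j) \<in> E. (z + (\<chi> i. p i)) $ j - (z + (\<chi> i. p i)) $ i - D j i) = neighbour_pull E z i"
      unfolding neighbour_pull_def by (rule sum.cong) (auto simp: assms(7))
    then show "\<bar>\<Sum>j | (i, j) \<in> E. (z + (\<chi> i. p i)) $ j - (z + (\<chi> i. p i)) $ i - D j i\<bar>
        \<le> 2 * real (graph_degree E i) * wbar"
      using limit_bound[of i] by simp
  qed
  moreover have "p i + (MIN j. x 0 $ j - p j) \<le> x t $ i \<and> x t $ i \<le> p i + (MAX j. x 0 $ j - p j)"
    if "0 \<le> t" for i t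
  proof -
    have "(MIN j. x 0 $ j - p j) \<le> x 0 $ j - p j" "x 0 $ j - p j \<le> (MAX j. x 0 $ j - p j)" for j
      by (auto intro: Min_le Max_ge)
    then show ?thesis
      using stays_above[OF order.refl that, of "MIN j. x 0 $ j - p j" i]
        stays_below[OF order.refl that, of "MAX j. x 0 $ j - p j" i] by simp
  qed
  ultimately show ?thesis
    by blast
qed

end
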